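(* Let $G$ be a finite group with exponent $e$, and let $\chi$ be a virtual character of $G$. Then $\chi$ is an integer-valued character if and only if $E_{Nr}(\lambda_t(\chi))\in Nr(CF(G))$ belongs to the image of the truncated operation $T_e:Nr(CF(G))\to Nr(CF(G))$. In particular, if $\chi$ satisfies these conditions, then $\lambda_t(\chi)$ has the finite product form $$\lambda_t(\chi)=\prod_{d\mid e}(1-(-t)^d)^{\alpha_d},$$ where $\alpha=(\alpha_1,\alpha_2,\alpha_3,\ldots)=E_{Nr}(\lambda_t(\chi))$.
   Context: The exponent of $G$ is the least common multiple of the orders of its elements. $CF(G)$ is the commutative $\mathbb{C}$-algebra of class functions $f:G\to\mathbb{C}$ with pointwise operations. A virtual character of $G$ is a $\mathbb{Z}$-linear combination of irreducible complex characters of $G$; it is called an integer-valued character if $\chi(g)\in\mathbb{Z}$ for all $g\in G$. $CF(G)$ carries the $\lambda$-ring structure whose $n$-th Adams operation is $\psi^n(f)(g)=f(g^n)$; explicitly, $\lambda_t(f)=\sum_{i\ge0}\lambda^i(f)t^i=\exp\big(-\sum_{i\ge1}\frac{\psi^i(f)}{i}(-t)^i\big)\in CF(G)[[t]]$ (if $\chi$ is the character of a representation, $\lambda^i(\chi)$ is the character of its $i$-th exterior power). For a commutative ring $R$, $\Lambda(R)=1+tR[[t]]$, and the necklace ring $Nr(R)$ is the set of infinite vectors $(x_1,x_2,x_3,\ldots)$ with entries in $R$, with componentwise addition and multiplication $(x\cdot_{Nr}y)_n=\sum_{[i,j]=n}(i,j)x_iy_j$, where $(i,j)$ and $[i,j]$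 denote gcd and lcm. For $R=CF(G)$ (a $\mathbb{Q}$-algebra), each $f\in\Lambda(R)$ can be written uniquely as $f(t)=\prod_{i\ge1}(1-(-t)^i)^{a_i}$ with $a_i\in R$, where $(1-u)^{a}=\sum_{k\ge0}(-1)^k\binom{a}{k}u^k$ and $\binom{a}{k}=a(a-1)\cdots(a-k+1)/k!$; one puts $E_{Nr}(f)=(a_1,a_2,a_3,\ldots)\in Nr(R)$. The $r$-th truncated operation $T_r:Nr(R)\to Nr(R)$ sends $(x_n)_n$ to $(y_n)_n$ with $y_n=x_n$ if $n\mid r$ and $y_n=0$ if $n\nmid r$. *)

theory Defs
  imports
    "HOL-Algebra.Multiplicative_Group"
    "Jordan_Normal_Form.VS_Connect"
begin

section \<open>Complex representations and characters\<close>

definition exponent :: "('a, 'm) monoid_scheme \<Rightarrow> nat" where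
  "exponent G = Lcm (group.ord G ` carrier G)"

text \<open>
  A representation of degree \<open>n\<close> is a homomorphism to \<open>GL\<^sub>n\<close>, the unit group of the ring of
  complex \<open>n \<times> n\<close> matrices.
\<close>

definition representation ::
  "('a, 'm) monoid_scheme \<Rightarrow> nat \<Rightarrow> ('a \<Rightarrow> complex mat) \<Rightarrow> bool" where
  "representation G n \<rho> \<longleftrightarrow> \<rho> \<in> hom G (units_of (ring_mat TYPE(complex) n ()))"

definition irreducible_representation ::
  "('a, 'm) monoid_scheme \<Rightarrow> nat \<Rightarrow> ('a \<Rightarrow> complex mat) \<Rightarrow> bool" where
  "irreducible_representation G n \<rho> \<longleftrightarrow>
     representation G n \<rho> \<and> n > 0 \<and>
     (\<forall>W. VectorSpace.subspace class_ring W (module_vec TYPE(complex) n) \<and>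
          (\<forall>g\<in>carrier G. \<forall>w\<in>W. \<rho> g *\<^sub>v w \<in> W)
        \<longrightarrow> W = {0\<^sub>v n} \<or> W = carrier_vec n)"

text \<open>
  Functions on the group are extensional, that is \<open>undefined\<close> outside the carrier, so
  that equality of functions is equality on the carrier.
\<close>

definition character ::
  "('a, 'm) monoid_scheme \<Rightarrow> ('a \<Rightarrow> complex mat) \<Rightarrow> 'a \<Rightarrow> complex" where
  "character G \<rho> = (\<lambda>g\<in>carrier G. sum_list (diag_mat (\<rho> g)))"

definition irreducible_characters :: "('a, 'm) monoid_scheme \<Rightarrow> ('a \<Rightarrow> complex) set" where
  "irreducible_characters G = {character G \<rho> | n \<rho>. irreducible_representation G n \<rho>}"

definition virtual_characters :: "('a, 'm) monoid_scheme \<Rightarrow> ('a \<Rightarrow> complex) set" where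
  "virtual_characters G =
     {(\<lambda>g\<in>carrier G. \<Sum>\<phi>\<in>S. of_int (c \<phi>) * \<phi> g) | S (c :: ('a \<Rightarrow> complex) \<Rightarrow> int).
        finite S \<and> S \<subseteq> irreducible_characters G}"

definition integer_valued :: "('a, 'm) monoid_scheme \<Rightarrow> ('a \<Rightarrow> complex) \<Rightarrow> bool" where
  "integer_valued G \<chi> \<longleftrightarrow> (\<forall>g\<in>carrier G. \<chi> g \<in> \<int>)"

definition CF :: "('a, 'm) monoid_scheme \<Rightarrow> ('a \<Rightarrow> complex) ring" where
  "CF G = \<lparr>
     carrier = {f \<in> extensional (carrier G).
                  \<forall>x\<in>carrier G. \<forall>y\<in>carrier G. f (y \<otimes>\<^bsub>G\<^esub> x \<otimes>\<^bsub>G\<^esub> inv\<^bsub>G\<^esub> y) = f x},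
     mult = (\<lambda>f h. \<lambda>g\<in>carrier G. f g * h g),
     one = (\<lambda>g\<in>carrier G. 1),
     zero = (\<lambda>g\<in>carrier G. 0),
     add = (\<lambda>f h. \<lambda>g\<in>carrier G. f g + h g)\<rparr>"


section \<open>Formal power series over a ring with explicit carrier\<close>

text \<open>A series is represented by its coefficient sequence.\<close>

definition PS :: "('b, 'm) ring_scheme \<Rightarrow> (nat \<Rightarrow> 'b) ring" where
  "PS R = \<lparr>
     carrier = UNIV \<rightarrow> carrier R,
     mult = (\<lambda>p q n. \<Oplus>\<^bsub>R\<^esub>i\<in>{..n}. p i \<otimes>\<^bsub>R\<^esub> q (n - i)),
     one = (\<lambda>n. if n = 0 then \<one>\<^bsub>R\<^esub> else \<zero>\<^bsub>R\<^esub>),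
     zero = (\<lambda>n. \<zero>\<^bsub>R\<^esub>),
     add = (\<lambda>p q n. p n \<oplus>\<^bsub>R\<^esub> q n)\<rparr>"

definition ps_const :: "('b, 'm) ring_scheme \<Rightarrow> 'b \<Rightarrow> nat \<Rightarrow> 'b" where
  "ps_const R a = (\<lambda>n. if n = 0 then a else \<zero>\<^bsub>R\<^esub>)"

text \<open>Limit in the \<open>t\<close>-adic topology: every coefficient is eventually constant.\<close>

definition ps_lim :: "(nat \<Rightarrow> nat \<Rightarrow> 'b) \<Rightarrow> nat \<Rightarrow> 'b" where
  "ps_lim F = (\<lambda>n. THE c. \<forall>\<^sub>F m in sequentially. F m n = c)"

text \<open>\<open>1 / n\<close> in a \<open>\<rat>\<close>-algebra.\<close>

definition recip :: "('b, 'm) ring_scheme \<Rightarrow> nat \<Rightarrow> 'b" where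
  "recip R n = inv\<^bsub>R\<^esub> ([n] \<cdot>\<^bsub>R\<^esub> \<one>\<^bsub>R\<^esub>)"

text \<open>\<open>exp h = \<Sum>k. h\<^sup>k / k!\<close>, for \<open>h\<close> with constant term zero.\<close>

definition ps_exp :: "('b, 'm) ring_scheme \<Rightarrow> (nat \<Rightarrow> 'b) \<Rightarrow> nat \<Rightarrow> 'b" where
  "ps_exp R h =
     ps_lim (\<lambda>m. \<Oplus>\<^bsub>PS R\<^esub>k\<in>{..m}. ps_const R (recip R (fact k)) \<otimes>\<^bsub>PS R\<^esub> (h [^]\<^bsub>PS R\<^esub> k))"

definition binom :: "('b, 'm) ring_scheme \<Rightarrow> 'b \<Rightarrow> nat \<Rightarrow> 'b" where
  "binom R a k = (\<Otimes>\<^bsub>R\<^esub>j\<in>{..<k}. a \<ominus>\<^bsub>R\<^esub> [j] \<cdot>\<^bsub>R\<^esub> \<one>\<^bsub>R\<^esub>) \<otimes>\<^bsub>R\<^esub> recip R (fact k)"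

text \<open>\<open>(1 - u)\<^sup>a\<close> as a series in \<open>u\<close>.\<close>

definition one_minus_pow :: "('b, 'm) ring_scheme \<Rightarrow> 'b \<Rightarrow> nat \<Rightarrow> 'b" where
  "one_minus_pow R a = (\<lambda>k. ((\<ominus>\<^bsub>R\<^esub> \<one>\<^bsub>R\<^esub>) [^]\<^bsub>R\<^esub> k) \<otimes>\<^bsub>R\<^esub> binom R a k)"

text \<open>
  Substitution of \<open>(- t)\<^sup>i\<close>, where \<open>i \<ge> 1\<close>, into a series in \<open>u\<close>: the term \<open>p k u\<^sup>k\<close> becomes
  \<open>(- 1)\<^sup>n p k t\<^sup>n\<close> with \<open>n = i k\<close>.
\<close>

definition ps_subst :: "('b, 'm) ring_scheme \<Rightarrow> (nat \<Rightarrow> 'b) \<Rightarrow> nat \<Rightarrow> nat \<Rightarrow> 'b" where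
  "ps_subst R p i =
     (\<lambda>n. if i dvd n then ((\<ominus>\<^bsub>R\<^esub> \<one>\<^bsub>R\<^esub>) [^]\<^bsub>R\<^esub> n) \<otimes>\<^bsub>R\<^esub> p (n div i) else \<zero>\<^bsub>R\<^esub>)"

text \<open>\<open>(1 - (- t)\<^sup>i)\<^sup>a\<close>\<close>

definition necklace_factor :: "('b, 'm) ring_scheme \<Rightarrow> nat \<Rightarrow> 'b \<Rightarrow> nat \<Rightarrow> 'b" where
  "necklace_factor R i a = ps_subst R (one_minus_pow R a) i"

definition Lam :: "('b, 'm) ring_scheme \<Rightarrow> (nat \<Rightarrow> 'b) set" where
  "Lam R = {f \<in> carrier (PS R). f 0 = \<one>\<^bsub>R\<^esub>}"


section \<open>Necklace rings\<close>

text \<open>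
  Vectors \<open>(x\<^sub>1, x\<^sub>2, \<dots>)\<close> are indexed from 1 and \<open>undefined\<close> at the index 0.  For \<open>n \<ge> 1\<close> only
  finitely many pairs satisfy \<open>lcm i j = n\<close>.
\<close>

definition Nr :: "('b, 'm) ring_scheme \<Rightarrow> (nat \<Rightarrow> 'b) ring" where
  "Nr R = \<lparr>
     carrier = {1..} \<rightarrow>\<^sub>E carrier R,
     mult = (\<lambda>x y. \<lambda>n\<in>{1..}. 
       finsum R (\<lambda>(i, j). [gcd i j] \<cdot>\<^bsub>R\<^esub> (x i \<otimes>\<^bsub>R\<^esub> y j)) {(i, j). lcm i j = n}),
     one = (\<lambda>n\<in>{1..}. if n = 1 then \<one>\<^bsub>R\<^esub> else \<zero>\<^bsub>R\<^esub>),
     zero = (\<lambda>n\<in>{1..}. \<zero>\<^bsub>R\<^esub>),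
     add = (\<lambda>x y. \<lambda>n\<in>{1..}. x n \<oplus>\<^bsub>R\<^esub> y n)\<rparr>"

definition E_Nr :: "('b, 'm) ring_scheme \<Rightarrow> (nat \<Rightarrow> 'b) \<Rightarrow> nat \<Rightarrow> 'b" where
  "E_Nr R = (\<lambda>f\<in>Lam R. THE a. a \<in> carrier (Nr R) \<and>
     f = ps_lim (\<lambda>m. \<Otimes>\<^bsub>PS R\<^esub>i\<in>{1..m}. necklace_factor R i (a i)))"

definition truncated :: "('b, 'm) ring_scheme \<Rightarrow> nat \<Rightarrow> (nat \<Rightarrow> 'b) \<Rightarrow> nat \<Rightarrow> 'b" where
  "truncated R r = (\<lambda>x\<in>carrier (Nr R). \<lambda>n\<in>{1..}. if n dvd r then x n else \<zero>\<^bsub>R\<^esub>)"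


section \<open>The lambda-ring structure on class functions\<close>

definition adams :: "('a, 'm) monoid_scheme \<Rightarrow> nat \<Rightarrow> ('a \<Rightarrow> complex) \<Rightarrow> 'a \<Rightarrow> complex" where
  "adams G n f = (\<lambda>g\<in>carrier G. f (g [^]\<^bsub>G\<^esub> n))"

definition lambda_t :: "('a, 'm) monoid_scheme \<Rightarrow> ('a \<Rightarrow> complex) \<Rightarrow> nat \<Rightarrow> 'a \<Rightarrow> complex" where
  "lambda_t G f = ps_exp (CF G) (\<ominus>\<^bsub>PS (CF G)\<^esub>
     (\<lambda>i. if i = 0 then \<zero>\<^bsub>CF G\<^esub>
          else ((\<ominus>\<^bsub>CF G\<^esub> \<one>\<^bsub>CF G\<^esub>) [^]\<^bsub>CF G\<^esub> i) \<otimes>\<^bsub>CF G\<^esub> (recip (CF G) i \<otimes>\<^bsub>CF G\<^esub> adams G i f)))"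

end

theory Submission
  imports Defs
    "HOL-Number_Theory.Residues"
    "HOL-Computational_Algebra.Formal_Power_Series"
    "Jordan_Normal_Form.Schur_Decomposition"
begin

text \<open>
  Comparing the logarithmic derivatives of \<open>\<lambda>\<^sub>t(\<chi>)\<close> and of the product of the
  \<open>(1 - (-t)\<^sup>i)\<^bsup>\<alpha>\<^sub>i\<^esup>\<close> at an element \<open>g\<close> shows that \<open>\<alpha>\<close> is determined by
  \<open>\<chi>(g\<^sup>n) = \<Sum>\<^bsub>d | n\<^esub> d \<alpha>\<^sub>d(g)\<close> for all \<open>n\<close>. Hence \<open>\<alpha>\<close> is supported on the divisors of \<open>e\<close> if and
  only if \<open>\<chi>(g\<^sup>n) = \<chi>(g\<^bsup>gcd(n, e)\<^esup>)\<close> for all \<open>g\<close> and \<open>n\<close>. The values of \<open>\<chi>\<close> are integral combinations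
  of \<open>e\<close>-th roots of unity, in particular algebraic integers. If the condition holds, averaging over
  \<open>n\<close> shows that they are rational, hence integers. Conversely, if all values are integers, then
  \<open>\<chi>(g\<^sup>p) \<equiv> \<chi>(g)\<^sup>p \<equiv> \<chi>(g)\<close> modulo every prime \<open>p\<close>, which is an equality for large \<open>p\<close>, and every residue class
  of numbers coprime to \<open>e / d\<close> contains a product of large primes.
\<close>

section \<open>Integral combinations of roots of unity\<close>

text \<open>The vector \<open>v\<close> is nonzero, hence an eigenvector of the integer matrix
  \<open>B\<close> with eigenvalue \<open>x\<close>. So \<open>x\<close> is a root of the
  characteristic polynomial of \<open>B\<close>, which is monic with integer coefficients.\<close>

lemma algebraic_int_if_int_matrix:
  fixes x :: complex and v :: "nat \<Rightarrow> complex" and B :: "nat \<Rightarrow> nat \<Rightarrow> int"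
  assumes "\<And>i. i < n \<Longrightarrow> x * v i = (\<Sum>j<n. of_int (B i j) * v j)"
    and "k < n" "v k \<noteq> 0"
  shows "algebraic_int x"
proof -
  define M where "M = Matrix.mat n n (\<lambda>(i,j). B i j)"
  have M: "M \<in> carrier_mat n n" by (simp add: M_def)
  let ?M = "map_mat complex_of_int M"
  have M': "?M \<in> carrier_mat n n" using M by simp
  have "eigenvector ?M (Matrix.vec n v) x"
    unfolding eigenvector_def
  proof (intro conjI)
    show "Matrix.vec n v \<in> carrier_vec (dim_row ?M)" using M' by simp
    show "Matrix.vec n v \<noteq> 0\<^sub>v (dim_row ?M)" using assms(2,3) M'
      by (metis M carrier_matD(1) index_map_mat(2) index_vec index_zero_vec(1))
    show "?M *\<^sub>v Matrix.vec n v = x \<cdot>\<^sub>v Matrix.vec n v"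
      using assms(1) by (intro eq_vecI)
        (auto simp: M_def scalar_prod_def lessThan_atLeast0 intro!: sum.cong)
  qed
  then have "poly (char_poly ?M) x = 0"
    using eigenvalue_root_char_poly[OF M'] unfolding eigenvalue_def by blast
  moreover have "char_poly ?M = map_poly of_int (char_poly M)"
    by (rule of_int_hom.char_poly_hom[OF M])
  moreover have "lead_coeff (char_poly M) = 1"
    using degree_monic_char_poly[OF M] by simp
  ultimately show ?thesis
    unfolding algebraic_int_altdef_ipoly by auto
qed

section \<open>The ring generated over the integers by a root of unity\<close>

definition root1 :: "nat \<Rightarrow> complex" where
  "root1 n = cis (2 * pi / n)"

lemma root1_power [simp]: "root1 n ^ n = 1"
  by (cases "n = 0") (simp_all add: root1_def DeMoivre)

lemma root1_power_mod: "root1 n ^ (k mod n) = root1 n ^ k"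
proof -
  have "root1 n ^ k = root1 n ^ (n * (k div n) + k mod n)" by simp
  also have "\<dots> = root1 n ^ (k mod n)" by (simp only: power_add power_mult root1_power) simp
  finally show ?thesis ..
qed

lemma root1_powerE:
  assumes "n > 0" "w ^ n = 1"
  obtains j where "j < n" "w = root1 n ^ j"
proof -
  have "w \<in> {z. z ^ n = 1}" using assms by simp
  then have "w \<in> (\<lambda>k. cis (2 * pi * real k / real n)) ` {..<n}"
    using bij_betw_roots_unity[OF assms(1)] by (simp add: bij_betw_def)
  then show ?thesis using that by (auto simp: root1_def DeMoivre algebra_simps)
qed

text \<open>The ring Z[\<open>root1 n\<close>]. Writing its elements as values of integer
  polynomials reduces closure under sums and products to polynomial arithmetic.\<close>

definition cyclotomic_ints :: "nat \<Rightarrow> complex set" where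
  "cyclotomic_ints n = range (\<lambda>f. poly (map_poly of_int f) (root1 n))"

lemma cyclotomic_intsI: "poly (map_poly of_int f) (root1 n) \<in> cyclotomic_ints n"
  by (simp add: cyclotomic_ints_def)

lemma cyclotomic_ints_add:
  assumes "x \<in> cyclotomic_ints n" "y \<in> cyclotomic_ints n"
  shows "x + y \<in> cyclotomic_ints n"
proof -
  obtain f g :: "int poly"
    where "x = poly (map_poly of_int f) (root1 n)" "y = poly (map_poly of_int g) (root1 n)"
    using assms by (auto simp: cyclotomic_ints_def)
  then have "x + y = poly (map_poly of_int (f + g)) (root1 n)"
    by (simp add: of_int_poly_hom.hom_add)
  then show ?thesis using cyclotomic_intsI by simp
qed

lemma cyclotomic_ints_mult:
  assumes "x \<in> cyclotomic_ints n" "y \<in> cyclotomic_ints n"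
  shows "x * y \<in> cyclotomic_ints n"
proof -
  obtain f g :: "int poly"
    where "x = poly (map_poly of_int f) (root1 n)" "y = poly (map_poly of_int g) (root1 n)"
    using assms by (auto simp: cyclotomic_ints_def)
  then have "x * y = poly (map_poly of_int (f * g)) (root1 n)"
    by (simp add: of_int_poly_hom.hom_mult)
  then show ?thesis using cyclotomic_intsI by simp
qed

lemma cyclotomic_ints_of_int [simp]: "of_int k \<in> cyclotomic_ints n"
  using cyclotomic_intsI[of "[:k:]" n] by (simp add: of_int_hom.map_poly_pCons_hom)

lemma cyclotomic_ints_of_nat [simp]: "of_nat k \<in> cyclotomic_ints n"
  using cyclotomic_ints_of_int[of "int k" n] by simp

lemma cyclotomic_ints_01 [simp]: "0 \<in> cyclotomic_ints n" "1 \<in> cyclotomic_ints n"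
  using cyclotomic_ints_of_int[of 0 n] cyclotomic_ints_of_int[of 1 n] by simp_all

lemma cyclotomic_ints_root1 [simp]: "root1 n \<in> cyclotomic_ints n"
  using cyclotomic_intsI[of "[:0,1:]" n] by simp

lemma cyclotomic_ints_power: "x \<in> cyclotomic_ints n \<Longrightarrow> x ^ k \<in> cyclotomic_ints n"
  by (induction k) (auto intro: cyclotomic_ints_mult)

lemma cyclotomic_ints_diff:
  assumes "x \<in> cyclotomic_ints n" "y \<in> cyclotomic_ints n"
  shows "x - y \<in> cyclotomic_ints n"
  using cyclotomic_ints_add[OF assms(1) cyclotomic_ints_mult[OF cyclotomic_ints_of_int[of "-1"] assms(2)]]
  by simp

lemma cyclotomic_ints_sum:
  "(\<And>i. i \<in> I \<Longrightarrow> f i \<in> cyclotomic_ints n) \<Longrightarrow> sum f I \<in> cyclotomic_ints n"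
  by (induction I rule: infinite_finite_induct) (auto intro: cyclotomic_ints_add)

text \<open>Since \<open>root1 n ^ n = 1\<close>, exponents may be reduced modulo \<open>n\<close>;
  the coefficients in each residue class are then collected.\<close>

lemma cyclotomic_ints_expansion:
  assumes "n > 0" "x \<in> cyclotomic_ints n"
  obtains b :: "nat \<Rightarrow> int" where "x = (\<Sum>j<n. of_int (b j) * root1 n ^ j)"
proof -
  obtain f :: "int poly" where f: "x = poly (map_poly of_int f) (root1 n)"
    using assms(2) by (auto simp: cyclotomic_ints_def)
  let ?I = "\<lambda>j. {i \<in> {..degree f}. i mod n = j}"
  have "x = (\<Sum>i\<le>degree f. of_int (coeff f i) * root1 n ^ (i mod n))"
    by (simp add: f poly_altdef root1_power_mod)
  also have "\<dots> = (\<Sum>j<n. \<Sum>i\<in>?I j. of_int (coeff f i) * root1 n ^ (i mod n))"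
    using assms(1) by (intro sum.group[symmetric]) auto
  also have "\<dots> = (\<Sum>j<n. of_int (\<Sum>i\<in>?I j. coeff f i) * root1 n ^ j)"
    by (auto simp: sum_distrib_right intro!: sum.cong)
  finally show ?thesis by (rule that)
qed

text \<open>Multiplication by \<open>x\<close> sends each power of \<open>root1 n\<close> to an
  integral combination of the first \<open>n\<close> powers. The vector of these powers, whose entry
  at index 0 is 1, is thus an eigenvector of an integer matrix.\<close>

lemma cyclotomic_ints_algebraic_int:
  assumes "n > 0" "x \<in> cyclotomic_ints n"
  shows "algebraic_int x"
proof -
  have "\<exists>b :: nat \<Rightarrow> int. x * root1 n ^ i = (\<Sum>j<n. of_int (b j) * root1 n ^ j)" for i
    using cyclotomic_ints_expansion[OF assms(1), of "x * root1 n ^ i"] assms(2)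
    by (metis cyclotomic_ints_mult cyclotomic_ints_power cyclotomic_ints_root1)
  then obtain b :: "nat \<Rightarrow> nat \<Rightarrow> int"
    where "\<And>i. x * root1 n ^ i = (\<Sum>j<n. of_int (b i j) * root1 n ^ j)" by metis
  then show ?thesis
    by (rule algebraic_int_if_int_matrix[of n _ "\<lambda>j. root1 n ^ j" b 0]) (use assms in auto)
qed

lemma cyclotomic_ints_rat:
  assumes "n > 0" "x \<in> cyclotomic_ints n" "x \<in> \<rat>"
  shows "x \<in> \<int>"
  using rational_algebraic_int_is_int[OF cyclotomic_ints_algebraic_int[OF assms(1,2)] assms(3)] .

section \<open>Congruences modulo a prime in the cyclotomic ring\<close>

text \<open>The inner binomial coefficients are divisible by \<open>p\<close>. The congruence
  carries an explicit quotient \<open>z\<close> from the ring, because divisibility by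
  \<open>p\<close> is void among complex numbers.\<close>

lemma binomial_power_cong:
  assumes "prime p" "x \<in> cyclotomic_ints n" "y \<in> cyclotomic_ints n"
  shows "\<exists>z\<in>cyclotomic_ints n. (x + y) ^ p = x ^ p + y ^ p + of_nat p * z"
proof -
  have p: "p > 1" using assms(1) prime_gt_1_nat by blast
  define z where "z = (\<Sum>k\<in>{1..<p}. of_nat ((p choose k) div p) * x ^ k * y ^ (p - k))"
  have "z \<in> cyclotomic_ints n" unfolding z_def
    by (intro cyclotomic_ints_sum cyclotomic_ints_mult cyclotomic_ints_power cyclotomic_ints_of_nat assms)
  moreover have "(x + y) ^ p = x ^ p + y ^ p + of_nat p * z"
  proof -
    have "{..p} = insert 0 (insert p {1..<p})" using p by auto
    then have "(x + y) ^ p = x ^ p + y ^ p + (\<Sum>k\<in>{1..<p}. of_nat (p choose k) * x ^ k * y ^ (p - k))"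
      using p by (simp add: binomial_ring)
    also have "(\<Sum>k\<in>{1..<p}. of_nat (p choose k) * x ^ k * y ^ (p - k)) = of_nat p * z"
      unfolding z_def sum_distrib_left
    proof (rule sum.cong)
      fix k assume "k \<in> {1..<p}"
      then have "p dvd (p choose k)" using assms(1) by (auto intro: dvd_choose_prime)
      then have "of_nat (p choose k) = (of_nat (p * ((p choose k) div p)) :: complex)" by simp
      then show "of_nat (p choose k) * x ^ k * y ^ (p - k) =
          of_nat p * (of_nat ((p choose k) div p) * x ^ k * y ^ (p - k))"
        by (simp only: of_nat_mult mult_ac)
    qed simp
    finally show ?thesis .
  qed
  ultimately show ?thesis by blast
qed

lemma sum_power_cong:
  assumes "prime p" "finite I" "\<And>i. i \<in> I \<Longrightarrow> f i \<in> cyclotomic_ints n"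
  shows "\<exists>z\<in>cyclotomic_ints n. (\<Sum>i\<in>I. f i) ^ p = (\<Sum>i\<in>I. f i ^ p) + of_nat p * z"
  using assms(2,3)
proof (induction I rule: finite_induct)
  case empty
  then show ?case using assms(1) by (auto simp: prime_gt_0_nat zero_power intro!: bexI[of _ 0])
next
  case (insert i I)
  obtain z where z: "z \<in> cyclotomic_ints n" "sum f I ^ p = (\<Sum>i\<in>I. f i ^ p) + of_nat p * z"
    using insert by auto
  obtain w where w: "w \<in> cyclotomic_ints n" "(f i + sum f I) ^ p = f i ^ p + sum f I ^ p + of_nat p * w"
    using binomial_power_cong[OF assms(1), of "f i" n "sum f I"] insert
    by (auto intro: cyclotomic_ints_sum)
  show ?case
    using insert z w by (intro bexI[of _ "z + w"]) (auto simp: algebra_simps intro: cyclotomic_ints_add)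
qed

lemma int_fermat_little:
  assumes "prime p"
  shows "\<exists>k. a ^ p = a + int p * k"
proof -
  have "[a ^ p = a] (mod int p)"
  proof (cases "int p dvd a")
    case True
    then show ?thesis using assms
      by (simp add: cong_0_iff cong_def mod_eq_0_iff_dvd dvd_power_le prime_gt_0_nat dvd_trans dvd_power)
  next
    case False
    \<comment> \<open>The residue is a natural number, so \<open>fermat_theorem\<close> applies to
      it even when \<open>a\<close> is negative.\<close>
    define b where "b = nat (a mod int p)"
    have p: "p > 0" using assms prime_gt_0_nat by blast
    have b: "int b = a mod int p" using p by (simp add: b_def)
    have "\<not> p dvd b" using False b by (metis dvd_mod_iff dvd_refl int_dvd_int_iff)
    then have "[b ^ (p - 1) = 1] (mod p)" using fermat_theorem assms by blast
    then have "[int b ^ (p - 1) = 1] (mod int p)" by (metis cong_int_iff of_nat_1 of_nat_power)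
    then have "[a ^ (p - 1) = 1] (mod int p)" using b by (simp add: cong_def power_mod)
    then have "[a * a ^ (p - 1) = a * 1] (mod int p)" by (rule cong_scalar_left)
    then show ?thesis using p by (cases p) auto
  qed
  then have "int p dvd a ^ p - a" by (simp add: cong_iff_dvd_diff)
  then obtain k where "a ^ p - a = int p * k" by blast
  then show ?thesis by (intro exI[of _ k]) simp
qed

text \<open>
  \<open>root_sum e c\<close> is the shape of \<open>n \<mapsto> \<chi> (g\<^sup>n)\<close> for a virtual character \<open>\<chi>\<close> and \<open>g\<^sup>e = 1\<close>:
  the numbers \<open>root1 e ^ j\<close> are the possible eigenvalues of \<open>g\<close>, the \<open>b j\<close> their multiplicities.
\<close>

definition root_sum :: "nat \<Rightarrow> (nat \<Rightarrow> complex) \<Rightarrow> bool" where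
  "root_sum e c \<longleftrightarrow> (\<exists>b :: nat \<Rightarrow> int. \<forall>n. c n = (\<Sum>j<e. of_int (b j) * (root1 e ^ j) ^ n))"

lemma root_sum_add: "root_sum e c \<Longrightarrow> root_sum e d \<Longrightarrow> root_sum e (\<lambda>n. c n + d n)"
  unfolding root_sum_def
proof (elim exE)
  fix b b' :: "nat \<Rightarrow> int"
  assume "\<forall>n. c n = (\<Sum>j<e. of_int (b j) * (root1 e ^ j) ^ n)"
    "\<forall>n. d n = (\<Sum>j<e. of_int (b' j) * (root1 e ^ j) ^ n)"
  then show "\<exists>b :: nat \<Rightarrow> int. \<forall>n. c n + d n = (\<Sum>j<e. of_int (b j) * (root1 e ^ j) ^ n)"
    by (intro exI[of _ "\<lambda>j. b j + b' j"]) (simp add: sum.distrib algebra_simps)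
qed

lemma root_sum_scale: "root_sum e c \<Longrightarrow> root_sum e (\<lambda>n. of_int k * c n)"
  unfolding root_sum_def
proof (elim exE)
  fix b :: "nat \<Rightarrow> int"
  assume "\<forall>n. c n = (\<Sum>j<e. of_int (b j) * (root1 e ^ j) ^ n)"
  then show "\<exists>b :: nat \<Rightarrow> int. \<forall>n. of_int k * c n = (\<Sum>j<e. of_int (b j) * (root1 e ^ j) ^ n)"
    by (intro exI[of _ "\<lambda>j. k * b j"]) (simp add: sum_distrib_left algebra_simps)
qed

lemma root_sum_0: "root_sum e (\<lambda>n. 0)"
  unfolding root_sum_def by (intro exI[of _ "\<lambda>_. 0"]) simp

lemma root_sum_sum: "(\<And>i. i \<in> I \<Longrightarrow> root_sum e (f i)) \<Longrightarrow> root_sum e (\<lambda>n. \<Sum>i\<in>I. f i n)"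
  by (induction I rule: infinite_finite_induct) (auto intro: root_sum_add root_sum_0)

lemma root_sum_power:
  assumes "e > 0" "w ^ e = 1"
  shows "root_sum e (\<lambda>n. w ^ n)"
proof -
  obtain j where "j < e" "w = root1 e ^ j" using root1_powerE[OF assms] by metis
  then show ?thesis unfolding root_sum_def
    by (intro exI[of _ "\<lambda>i. if i = j then 1 else 0"])
       (simp add: if_distrib[of "\<lambda>x. x * _"] if_distrib[of of_int] sum.delta cong: if_cong)
qed

lemma root_sum_cyclotomic_int: "root_sum e c \<Longrightarrow> c n \<in> cyclotomic_ints e"
  unfolding root_sum_def
  by (auto intro!: cyclotomic_ints_sum cyclotomic_ints_mult cyclotomic_ints_power)

text \<open>Raising the sum for \<open>c n\<close> to the power \<open>p\<close> termwise and using
  \<open>b j ^ p\<close> = \<open>b j\<close> modulo \<open>p\<close> shows that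
  \<open>c n ^ p\<close> and \<open>c (n * p)\<close> are congruent modulo \<open>p\<close> in the
  cyclotomic ring. By Fermat, \<open>c n ^ p\<close> is congruent to \<open>u\<close>.\<close>

lemma root_sum_frobenius:
  assumes "root_sum e c" "prime p" "e > 0"
    and "c n = of_int u" "c (n * p) = of_int v"
  shows "int p dvd v - u"
proof -
  obtain b :: "nat \<Rightarrow> int" where b: "\<And>n. c n = (\<Sum>j<e. of_int (b j) * (root1 e ^ j) ^ n)"
    using assms(1) by (auto simp: root_sum_def)
  let ?w = "\<lambda>j. (root1 e ^ j) ^ n"
  have w: "?w j \<in> cyclotomic_ints e" for j by (intro cyclotomic_ints_power cyclotomic_ints_root1)
  obtain z where z: "z \<in> cyclotomic_ints e"
    "c n ^ p = (\<Sum>j<e. (of_int (b j) * ?w j) ^ p) + of_nat p * z"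
    using sum_power_cong[OF assms(2) finite_lessThan, of e "\<lambda>j. of_int (b j) * ?w j" e, OF cyclotomic_ints_mult[OF cyclotomic_ints_of_int w]]
    by (auto simp: b)
  have "\<forall>j. \<exists>k. b j ^ p = b j + int p * k" using int_fermat_little[OF assms(2)] by blast
  then obtain k where k: "\<And>j. b j ^ p = b j + int p * k j" by metis
  define y where "y = (\<Sum>j<e. of_int (k j) * ?w j ^ p)"
  have y: "y \<in> cyclotomic_ints e"
    unfolding y_def by (intro cyclotomic_ints_sum cyclotomic_ints_mult cyclotomic_ints_power w) simp
  have "(of_int (b j) * ?w j) ^ p = of_int (b j) * (root1 e ^ j) ^ (n * p) + of_nat p * (of_int (k j) * ?w j ^ p)" for j
  proof -
    have "(of_int (b j) * ?w j) ^ p = of_int (b j ^ p) * ?w j ^ p"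
      by (simp add: power_mult_distrib)
    also have "\<dots> = of_int (b j) * ?w j ^ p + of_nat p * (of_int (k j) * ?w j ^ p)"
      by (simp only: k of_int_add of_int_mult of_int_of_nat_eq ring_distribs mult_ac)
    finally show ?thesis by (simp only: power_mult)
  qed
  then have "c n ^ p = c (n * p) + of_nat p * (y + z)"
    by (simp add: z(2) b[of "n * p"] y_def sum.distrib sum_distrib_left algebra_simps)
  moreover obtain l where l: "u ^ p = u + int p * l" using int_fermat_little[OF assms(2)] by blast
  ultimately have "of_int (u + int p * l) = of_int v + of_nat p * (y + z)"
    using assms(4,5) by (metis of_int_power)
  then have eq: "of_int (v - u) = of_nat p * (of_int l - (y + z))"
    by (simp add: algebra_simps)
  have p: "p > 0" using assms(2) prime_gt_0_nat by blast
  \<comment> \<open>The congruence descends to the integers: the quotient lies in the cyclotomic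
    ring and equals \<open>(v - u) / p\<close>, so it is a rational algebraic integer.\<close>
  let ?x = "of_int l - (y + z)"
  have "?x = of_int (v - u) / of_nat p" using eq p by simp
  then have "?x \<in> \<rat>" by simp
  moreover have "?x \<in> cyclotomic_ints e" by (intro cyclotomic_ints_diff cyclotomic_ints_add y z(1)) simp
  ultimately have "?x \<in> \<int>" using cyclotomic_ints_rat[OF assms(3)] by blast
  then obtain q where "?x = of_int q" using Ints_cases by blast
  then have "complex_of_int (v - u) = of_int (int p * q)" using eq by simp
  then have "v - u = int p * q" by (simp only: of_int_eq_iff)
  then show ?thesis by simp
qed


section \<open>Integral values and dependence on the gcd with the period\<close>

lemma root_sum_mod: "root_sum e c \<Longrightarrow> c (n mod e) = c n"
proof -
  assume "root_sum e c"
  moreover have "(root1 e ^ j) ^ (n mod e) = (root1 e ^ j) ^ n" for j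
  proof -
    have swap: "(root1 e ^ j) ^ k = (root1 e ^ k) ^ j" for k
      by (simp add: power_mult[symmetric] mult.commute)
    show ?thesis by (simp only: swap root1_power_mod)
  qed
  ultimately show ?thesis by (auto simp: root_sum_def)
qed

lemma root_sum_cong: "root_sum e c \<Longrightarrow> [m = n] (mod e) \<Longrightarrow> c m = c n"
  by (metis root_sum_mod cong_def)

lemma root_sum_finite_range:
  assumes "root_sum e c" "e > 0"
  shows "finite (range c)"
proof -
  have "range c \<subseteq> c ` {..<e}"
  proof
    fix x assume "x \<in> range c"
    then obtain n where "x = c n" by blast
    then have "x = c (n mod e)" using root_sum_mod[OF assms(1)] by simp
    then show "x \<in> c ` {..<e}" using assms(2) by simp
  qed
  then show ?thesis by (rule finite_subset) simp
qed

text \<open>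
  Landau's trick: for a large prime \<open>p\<close> the congruence \<open>c (n p) \<equiv> c n\<close> modulo \<open>p\<close> between
  integers of bounded size is an equality, and every residue class coprime to \<open>N\<close> contains a
  number all of whose prime factors are large.
\<close>

lemma root_sum_large_prime:
  assumes "root_sum e c" "e > 0" "\<And>n. c n \<in> \<int>"
  obtains A where "\<And>n p. prime p \<Longrightarrow> p > A \<Longrightarrow> c (n * p) = c n"
proof -
  have "\<exists>k. c n = of_int k" for n
    by (rule Ints_cases[OF assms(3)[of n]]) blast
  then obtain u where u: "\<And>n. c n = of_int (u n)" by metis
  have "finite (range (\<lambda>n. complex_of_int (u n)))"
    using root_sum_finite_range[OF assms(1,2)] by (simp only: u[symmetric])
  then have fin: "finite (range u)"
    by (intro finite_imageD[where f = complex_of_int]) (auto simp: image_image inj_on_def)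
  \<comment> \<open>Twice the largest absolute value bounds the difference of any two values, so
    \<open>A\<close> works for all \<open>n\<close> at once.\<close>
  define A where "A = nat (2 * Max (abs ` range u))"
  have "c (n * p) = c n" if p: "prime p" "p > A" for n p
  proof -
    have le: "\<bar>u m\<bar> \<le> Max (abs ` range u)" for m
      by (rule Max_ge) (use fin in simp_all)
    have "\<bar>u (n * p) - u n\<bar> \<le> \<bar>u (n * p)\<bar> + \<bar>u n\<bar>" by simp
    also have "\<dots> \<le> 2 * Max (abs ` range u)" using le[of n] le[of "n * p"] by simp
    also have "\<dots> < int p" using p(2) unfolding A_def by linarith
    finally have "\<bar>u (n * p) - u n\<bar> < int p" .
    moreover have "int p dvd u (n * p) - u n"
      using root_sum_frobenius[OF assms(1) p(1) assms(2)] u by blast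
    ultimately have "u (n * p) - u n = 0"
      using dvd_imp_le_int[of "u (n * p) - u n" "int p"] by linarith
    then show ?thesis by (simp add: u)
  qed
  then show ?thesis by (rule that)
qed

lemma cong_large_prime_factors:
  fixes m N A :: nat
  assumes "coprime m N" "N > 0"
  obtains M where "M > 0" "[M = m] (mod N)" "\<And>p. prime p \<Longrightarrow> p dvd M \<Longrightarrow> p > A"
proof -
  \<comment> \<open>Every prime up to \<open>A\<close> divides exactly one of the summands of
    \<open>m + N * P\<close>, unless it divides \<open>m\<close>; in that case coprimality keeps it
    away from \<open>N\<close>, and the choice of factors keeps it away from \<open>P\<close>.
    Either way it does not divide the sum. This construction takes the place of Dirichlet's
    theorem.\<close>
  define P where "P = \<Prod>{p \<in> {..A}. prime p \<and> \<not> p dvd m}"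
  have P: "P > 0" unfolding P_def by (intro prod_pos) (auto simp: prime_gt_0_nat)
  let ?M = "m + N * P"
  have "p > A" if p: "prime p" "p dvd ?M" for p
  proof (rule ccontr)
    assume "\<not> p > A"
    then have "p \<le> A" by simp
    show False
    proof (cases "p dvd m")
      case True
      then have "p dvd N * P" using p(2) by (simp add: dvd_add_right_iff)
      moreover have "\<not> p dvd N" using True assms(1) p(1)
        by (metis coprime_common_divisor_nat not_prime_1)
      ultimately have "p dvd P" using p(1) prime_dvd_mult_iff by blast
      then obtain q where q: "prime q" "\<not> q dvd m" "p dvd q"
        unfolding P_def using p(1) by (auto simp: prime_dvd_prod_iff)
      then have "p = q" using p(1) primes_dvd_imp_eq by blast
      then show False using q True by simp
    next
      case False
      then have "p dvd P" unfolding P_def using \<open>p \<le> A\<close> p(1)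
        by (intro dvd_prodI[where f = "\<lambda>x. x", simplified]) auto
      then have "p dvd m" using p(2) by (metis dvd_add_left_iff dvd_mult)
      then show False using False by simp
    qed
  qed
  note large = this
  show ?thesis
  proof (rule that[of ?M])
    show "?M > 0" using assms(2) P by simp
    show "[?M = m] (mod N)" by (simp add: cong_def)
  qed (rule large)
qed

text \<open>Write \<open>n = d * m\<close> and \<open>e = d * N\<close> with
  \<open>d = gcd n e\<close>, so that \<open>m\<close> and \<open>N\<close> are coprime. By
  periodicity \<open>m\<close> may be replaced by any \<open>M\<close> congruent to it modulo
  \<open>N\<close>. If all prime factors of \<open>M\<close> are large, they can be stripped off one
  at a time, which leaves \<open>c d\<close>.\<close>

lemma root_sum_Ints_imp_gcd:
  assumes "root_sum e c" "e > 0" "\<And>n. c n \<in> \<int>" "n > 0"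
  shows "c n = c (gcd n e)"
proof -
  obtain A where A: "\<And>n p. prime p \<Longrightarrow> p > A \<Longrightarrow> c (n * p) = c n"
    using root_sum_large_prime[OF assms(1,2,3)] by metis
  define d where "d = gcd n e"
  have d: "d > 0" "d dvd n" "d dvd e" using assms(2) by (auto simp: d_def)
  define m N where "m = n div d" and "N = e div d"
  have mN: "n = d * m" "e = d * N" using d by (auto simp: m_def N_def)
  have "coprime m N" unfolding m_def N_def d_def using assms(2) by (intro div_gcd_coprime) auto
  moreover have "N > 0" using mN assms(2) by simp
  ultimately obtain M where M: "M > 0" "[M = m] (mod N)" "\<And>p. prime p \<Longrightarrow> p dvd M \<Longrightarrow> p > A"
    using cong_large_prime_factors[of m N A] by metis
  have "c (d * M) = c d"
    using M(1,3)
  proof (induction M rule: less_induct)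
    case (less M)
    show ?case
    proof (cases "M = 1")
      case False
      then obtain p where p: "prime p" "p dvd M" using prime_factor_nat by blast
      then obtain K where K: "M = K * p" by (metis dvd_def mult.commute)
      have "K > 0" "K < M" using less.prems(1) p(1) prime_gt_1_nat[of p] by (auto simp: K)
      then have "c (d * K) = c d" using less.prems(2) by (intro less.IH) (auto simp: K)
      moreover have "c (d * K * p) = c (d * K)" using A p less.prems(2) by blast
      ultimately show ?thesis by (simp add: K mult.assoc)
    qed simp
  qed
  moreover have "[d * M = d * m] (mod d * N)" using M(2) by (metis cong_def mult_mod_right)
  then have "c (d * M) = c n" using root_sum_cong[OF assms(1)] mN by simp
  ultimately show ?thesis by (simp add: d_def)
qed

text \<open>The sum is \<open>N\<close> for \<open>w = 1\<close>, and otherwise 0 by the geometric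
  series.\<close>

lemma sum_roots_unity_Rats:
  assumes "w ^ N = (1 :: complex)"
  shows "(\<Sum>n=1..N. w ^ n) \<in> \<rat>"
proof (cases "w = 1")
  case False
  have "(\<Sum>n=1..N. w ^ n) = w * (\<Sum>n<N. w ^ n)"
    by (simp add: sum_distrib_left sum.shift_bounds_nat_ivl lessThan_atLeast0 sum.atLeast1_atMost_eq)
  also have "(\<Sum>n<N. w ^ n) = 0" using False assms by (simp add: geometric_sum)
  finally show ?thesis by simp
qed simp

text \<open>
  The sum of \<open>c\<close> over the multiples of \<open>d\<close> modulo \<open>e\<close> is rational, and its terms are
  \<open>c d\<close>, repeated, and values \<open>c d'\<close> with \<open>d'\<close> a proper multiple of \<open>d\<close>; so all \<open>c d\<close> with
  \<open>d\<close> dividing \<open>e\<close> are rational by induction.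
\<close>

lemma root_sum_gcd_imp_Ints:
  assumes "root_sum e c" "e > 0" "\<And>n. n > 0 \<Longrightarrow> c n = c (gcd n e)"
  shows "c 1 \<in> \<int>"
proof -
  obtain b :: "nat \<Rightarrow> int" where b: "\<And>n. c n = (\<Sum>j<e. of_int (b j) * (root1 e ^ j) ^ n)"
    using assms(1) by (auto simp: root_sum_def)
  \<comment> \<open>The induction is on the cofactor \<open>N = e / d\<close>, which shrinks when
    \<open>d\<close> is replaced by a proper multiple dividing \<open>e\<close>.\<close>
  have "c d \<in> \<rat>" if "e = d * N" for d N
    using that
  proof (induction N arbitrary: d rule: less_induct)
    case (less N)
    have pos: "d > 0" "N > 0" using less.prems assms(2) by auto
    have gcd: "c (d * n) = c (d * gcd n N)" if "n > 0" for n
      using assms(3)[of "d * n"] that pos less.prems by (simp add: gcd_mult_distrib_nat)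
    \<comment> \<open>After exchanging the sums, each inner sum runs over the powers of
      \<open>(root1 e ^ j) ^ d\<close>, an \<open>N\<close>-th root of unity since
      \<open>d * N = e\<close>.\<close>
    have "(\<Sum>n=1..N. c (d * n)) = (\<Sum>j<e. of_int (b j) * (\<Sum>n=1..N. ((root1 e ^ j) ^ d) ^ n))"
      unfolding b sum_distrib_left by (subst sum.swap) (simp add: power_mult)
    also have "\<dots> \<in> \<rat>"
    proof (rule Rats_sum, rule Rats_mult, simp, rule sum_roots_unity_Rats)
      fix j
      have "((root1 e ^ j) ^ d) ^ N = (root1 e ^ e) ^ j"
        using less.prems by (metis mult.commute power_mult)
      then show "((root1 e ^ j) ^ d) ^ N = 1" by simp
    qed
    finally have total: "(\<Sum>n=1..N. c (d * n)) \<in> \<rat>" .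
    let ?C = "{n \<in> {1..N}. coprime n N}" and ?D = "{n \<in> {1..N}. \<not> coprime n N}"
    have "(\<Sum>n=1..N. c (d * n)) = (\<Sum>n\<in>?C. c (d * n)) + (\<Sum>n\<in>?D. c (d * n))"
      by (subst sum.union_disjoint[symmetric]) (auto intro!: sum.cong)
    moreover have "(\<Sum>n\<in>?C. c (d * n)) = of_nat (card ?C) * c d"
    proof -
      have "c (d * n) = c d" if "n \<in> ?C" for n
        using gcd[of n] that by simp
      then show ?thesis by simp
    qed
    moreover have "(\<Sum>n\<in>?D. c (d * n)) \<in> \<rat>"
    proof (rule Rats_sum)
      fix n assume n: "n \<in> ?D"
      let ?g = "gcd n N"
      have "?g \<noteq> 1" using n coprime_iff_gcd_eq_1 by blast
      moreover have "?g \<noteq> 0" using pos(2) by simp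
      ultimately have g: "?g > 1" by linarith
      define K where "K = N div ?g"
      have K: "?g * K = N" unfolding K_def by (rule dvd_mult_div_cancel) simp
      then have "K > 0" using pos(2) by (cases "K = 0") simp_all
      then have "1 * K < ?g * K" using g by (rule mult_strict_right_mono[rotated])
      then have "K < N" unfolding K by simp
      moreover have "e = d * ?g * K" unfolding mult.assoc K by (rule less.prems)
      ultimately have "c (d * ?g) \<in> \<rat>" by (rule less.IH)
      moreover have "n > 0" using n by simp
      ultimately show "c (d * n) \<in> \<rat>" using gcd[of n] by metis
    qed
    \<comment> \<open>Only the indices coprime to \<open>N\<close> remain, each contributing
      \<open>c d\<close>. Their number is nonzero because 1 is among them, so it can be divided
      out.\<close>
    ultimately have "of_nat (card ?C) * c d \<in> \<rat>"
      using total Rats_diff[of "(\<Sum>n=1..N. c (d * n))" "(\<Sum>n\<in>?D. c (d * n))"] by simp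
    then have "of_nat (card ?C) * c d / of_nat (card ?C) \<in> \<rat>" by (rule Rats_divide) simp
    moreover have "finite ?C" by simp
    moreover have "1 \<in> ?C" using pos(2) by simp
    ultimately have "card ?C > 0" "of_nat (card ?C) * c d / of_nat (card ?C) \<in> \<rat>"
      using card_gt_0_iff by blast+
    moreover have "of_nat k * c d / of_nat k = c d" if "k > 0" for k :: nat using that by simp
    ultimately show ?case by metis
  qed
  from this[of 1 e] have "c 1 \<in> \<rat>" by simp
  then show ?thesis
    using cyclotomic_ints_rat[OF assms(2) root_sum_cyclotomic_int[OF assms(1)]] by blast
qed

section \<open>Necklace products of complex power series\<close>

no_notation vec_index (infixl "$" 100)
unbundle fps_syntax

text \<open>
  \<open>D = t F' / F\<close>, written without division; it turns products into sums and, together with the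
  constant term, determines \<open>F\<close>.
\<close>

definition euler_deriv_factor :: "complex fps \<Rightarrow> complex fps \<Rightarrow> bool" where
  "euler_deriv_factor F D \<longleftrightarrow> fps_X * fps_deriv F = F * D"

lemma fps_X_mult_deriv_nth: "(fps_X * fps_deriv F) $ n = of_nat n * F $ n"
  by (cases n) simp_all

text \<open>As \<open>D $ 0 = 0\<close>, comparing coefficients expresses \<open>n * F $ n\<close>
  through earlier coefficients of \<open>F\<close> and the coefficients of \<open>D\<close> up to
  degree \<open>n\<close>. Requiring agreement only up to \<open>n\<close> allows finite partial
  products to be compared with each other.\<close>

lemma euler_deriv_factor_nth_cong:
  assumes "euler_deriv_factor F D" "euler_deriv_factor G E" "F $ 0 = G $ 0"
    and "D $ 0 = 0" "\<And>k. k \<le> n \<Longrightarrow> D $ k = E $ k"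
  shows "F $ n = G $ n"
  using assms(5)
proof (induction n rule: less_induct)
  case (less n)
  show ?case
  proof (cases "n = 0")
    case False
    have rec: "of_nat n * F' $ n = (\<Sum>i=0..<n. F' $ i * D' $ (n - i))"
      if "euler_deriv_factor F' D'" "D' $ 0 = 0" for F' D'
    proof -
      have "of_nat n * F' $ n = (F' * D') $ n"
        using that(1) fps_X_mult_deriv_nth[of F' n] by (simp add: euler_deriv_factor_def)
      also have "\<dots> = (\<Sum>i=0..n. F' $ i * D' $ (n - i))" by (rule fps_mult_nth)
      also have "\<dots> = (\<Sum>i=0..<n. F' $ i * D' $ (n - i))"
        using that(2) by (simp add: sum.last_plus)
      finally show ?thesis .
    qed
    have "E $ 0 = 0" using less.prems[of 0] assms(4) by simp
    then have "of_nat n * F $ n = of_nat n * G $ n"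
      unfolding rec[OF assms(1,4)] using rec[OF assms(2)] less by (auto intro!: sum.cong)
    then show ?thesis using False by simp
  qed (simp add: assms(3))
qed

lemma euler_deriv_factor_unique:
  assumes "euler_deriv_factor F D" "euler_deriv_factor G D" "F $ 0 = G $ 0" "D $ 0 = 0"
  shows "F = G"
  using euler_deriv_factor_nth_cong[OF assms] by (simp add: fps_eq_iff)

lemma euler_deriv_factor_mult:
  assumes "euler_deriv_factor F D" "euler_deriv_factor G E"
  shows "euler_deriv_factor (F * G) (D + E)"
proof -
  have "fps_X * fps_deriv (F * G) = F * (fps_X * fps_deriv G) + (fps_X * fps_deriv F) * G"
    by (simp add: algebra_simps)
  also have "\<dots> = F * G * (D + E)"
    using assms unfolding euler_deriv_factor_def by (simp add: algebra_simps)
  finally show ?thesis by (simp add: euler_deriv_factor_def)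
qed

lemma euler_deriv_factor_prod:
  assumes "finite I" "\<And>i. i \<in> I \<Longrightarrow> euler_deriv_factor (F i) (D i)"
  shows "euler_deriv_factor (\<Prod>i\<in>I. F i) (\<Sum>i\<in>I. D i)"
  using assms
proof (induction I rule: finite_induct)
  case empty
  then show ?case by (simp add: euler_deriv_factor_def)
qed (simp add: euler_deriv_factor_mult)

lemma euler_deriv_factor_exp:
  fixes h :: "complex fps"
  assumes "h $ 0 = 0"
  shows "euler_deriv_factor (fps_exp 1 oo h) (fps_X * fps_deriv h)"
  using assms by (simp add: euler_deriv_factor_def fps_compose_deriv algebra_simps)

section \<open>The factors of the product and their logarithmic derivatives\<close>

text \<open>The complex counterpart of \<open>necklace_factor\<close>: \<open>fps_binomial a\<close>
  is (1 + u)^a, and u = -(-t)^i is substituted.\<close>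

definition necklace_fps :: "nat \<Rightarrow> complex \<Rightarrow> complex fps" where
  "necklace_fps i a = fps_binomial a oo (- ((- fps_X) ^ i))"

lemma minus_X_power: "(- fps_X :: complex fps) ^ i = fps_const ((-1) ^ i) * fps_X ^ i"
  by (induction i) (simp_all add: algebra_simps flip: fps_const_neg)

lemma minus_minus_X_power_nth:
  "(- ((- fps_X :: complex fps) ^ i)) ^ k $ n = (if n = i * k then (-1) ^ (n + k) else 0)"
proof -
  have 1: "- ((- fps_X :: complex fps) ^ i) = fps_const (- ((-1) ^ i)) * fps_X ^ i"
    by (simp only: minus_X_power fps_const_neg[symmetric] mult_minus_left)
  have 2: "(- ((-1) ^ i)) ^ k = ((-1) ^ (i * k + k) :: complex)"
    by (simp only: power_minus[of "(-1) ^ i"] power_add power_mult mult.commute)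
  show ?thesis
    unfolding 1 power_mult_distrib fps_const_power 2 power_mult[symmetric]
    by (simp only: fps_mult_left_const_nth fps_X_power_nth mult_1_right mult_zero_right if_distrib cong: if_cong) simp
qed

text \<open>The signs are grouped as in \<open>ps_subst\<close> and \<open>one_minus_pow\<close>, so
  that the evaluated \<open>necklace_factor\<close> can be matched with this formula
  directly.\<close>

lemma necklace_fps_nth:
  assumes "i > 0"
  shows "necklace_fps i a $ n =
    (if i dvd n then (-1) ^ n * ((-1) ^ (n div i) * (a gchoose (n div i))) else 0)"
proof -
  have "necklace_fps i a $ n = (\<Sum>k=0..n. (a gchoose k) * (if n = i * k then (-1) ^ (n + k) else 0))"
    by (simp add: necklace_fps_def fps_compose_nth minus_minus_X_power_nth)
  also have "\<dots> = (\<Sum>k\<in>(if i dvd n then {n div i} else {}). (a gchoose k) * (if n = i * k then (-1) ^ (n + k) else 0))"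
    using assms by (intro sum.mono_neutral_right) (auto split: if_splits)
  also have "\<dots> = (if i dvd n then (-1) ^ n * ((-1) ^ (n div i) * (a gchoose (n div i))) else 0)"
    by (simp add: power_add)
  finally show ?thesis .
qed

text \<open>With w = (-t)^i this is the expansion of t d/dt (a log(1 - w)) = -i a w / (1 - w), a
  geometric series.\<close>

definition necklace_log :: "nat \<Rightarrow> complex \<Rightarrow> complex fps" where
  "necklace_log i a = Abs_fps (\<lambda>n. if n > 0 \<and> i dvd n then - ((-1) ^ n * (of_nat i * a)) else 0)"

lemma necklace_log_nth:
  "necklace_log i a $ n = (if n > 0 \<and> i dvd n then - ((-1) ^ n * (of_nat i * a)) else 0)"
  by (simp add: necklace_log_def)

lemma necklace_log_mult:
  assumes "i > 0"
  shows "necklace_log i a * (1 - (- fps_X) ^ i) = fps_const (of_nat i * a) * - ((- fps_X) ^ i)"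
proof (rule fps_ext)
  fix n
  have "(necklace_log i a * (1 - (- fps_X) ^ i)) $ n =
      necklace_log i a $ n - (fps_const ((-1) ^ i) * (fps_X ^ i * necklace_log i a)) $ n"
    by (simp add: minus_X_power algebra_simps)
  also have "\<dots> = necklace_log i a $ n - (if n < i then 0 else (-1) ^ i * necklace_log i a $ (n - i))"
    by (simp add: fps_X_power_mult_nth)
  also have "\<dots> = (if n = i then - ((-1) ^ i * (of_nat i * a)) else 0)"
  proof (cases "n < i")
    case True
    then show ?thesis by (auto simp: necklace_log_nth dest: dvd_imp_le)
  next
    case False
    then obtain m where "n = m + i" by (metis le_add_diff_inverse2 not_less)
    then show ?thesis using assms by (auto simp: necklace_log_nth power_add)
  qed
  also have "\<dots> = (fps_const (of_nat i * a) * - ((- fps_X) ^ i)) $ n"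
    by (simp add: minus_X_power fps_X_power_nth)
  finally show "(necklace_log i a * (1 - (- fps_X) ^ i)) $ n = \<dots>" .
qed

text \<open>The binomial series satisfies (1 + X) B' = a B. Substituting u = -(-t)^i and using t u'
  = i u gives the claim multiplied by 1 + u, which is nonzero and cancels.\<close>

lemma euler_deriv_factor_necklace:
  assumes "i > 0"
  shows "euler_deriv_factor (necklace_fps i a) (necklace_log i a)"
proof -
  define u :: "complex fps" where "u = - ((- fps_X) ^ i)"
  let ?B = "fps_binomial a" and ?F = "necklace_fps i a"
  have u0: "u $ 0 = 0" using assms by (simp add: u_def)
  have F: "?F = ?B oo u" by (simp add: necklace_fps_def u_def)
  have "(1 + fps_X) * fps_deriv ?B = fps_const a * ?B"
  proof -
    have unit: "(1 + fps_X) * inverse (1 + fps_X) = (1 :: complex fps)"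
      by (rule inverse_mult_eq_1') simp
    have "fps_deriv ?B = fps_const a * ?B * inverse (1 + fps_X)"
      unfolding fps_binomial_deriv by (rule fps_divide_unit) simp
    then have "(1 + fps_X) * fps_deriv ?B = fps_const a * ?B * ((1 + fps_X) * inverse (1 + fps_X))"
      by (simp only: mult_ac)
    then show ?thesis by (simp only: unit mult_1_right)
  qed
  then have "((1 + fps_X) * fps_deriv ?B) oo u = (fps_const a * ?B) oo u" by simp
  then have ode: "(1 + u) * (fps_deriv ?B oo u) = fps_const a * ?F"
    by (simp only: F fps_compose_mult_distrib[OF u0] fps_compose_add_distrib fps_compose_1
        fps_X_fps_compose_startby0[OF u0] fps_const_compose)
  have Xu: "fps_X * fps_deriv u = fps_const (of_nat i) * u"
  proof (rule fps_ext)
    fix n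
    show "(fps_X * fps_deriv u) $ n = (fps_const (of_nat i) * u) $ n"
      unfolding fps_X_mult_deriv_nth u_def minus_X_power by simp
  qed
  have "(1 + u) * (fps_X * fps_deriv ?F) = ((1 + u) * (fps_deriv ?B oo u)) * (fps_X * fps_deriv u)"
    unfolding F fps_compose_deriv[OF u0] by (simp only: mult_ac)
  also have "\<dots> = ?F * (fps_const (of_nat i * a) * u)"
    unfolding ode Xu fps_const_mult[symmetric] by (simp only: mult_ac)
  also have "fps_const (of_nat i * a) * u = necklace_log i a * (1 + u)"
    using necklace_log_mult[OF assms, of a] by (simp add: u_def)
  also have "?F * (necklace_log i a * (1 + u)) = (1 + u) * (?F * necklace_log i a)"
    by (simp only: mult_ac)
  finally have "(1 + u) * (fps_X * fps_deriv ?F) = (1 + u) * (?F * necklace_log i a)" .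
  moreover have "(1 + u) $ 0 \<noteq> 0" using u0 by simp
  then have "1 + u \<noteq> 0" by (metis fps_zero_nth)
  ultimately show ?thesis unfolding euler_deriv_factor_def by simp
qed

lemma necklace_fps_nth_0 [simp]: "necklace_fps i a $ 0 = 1"
  by (simp add: necklace_fps_def)

lemma fps_prod_nth_0: "(\<Prod>i\<in>I. F i) $ 0 = (\<Prod>i\<in>I. (F i :: complex fps) $ 0)"
  by (induction I rule: infinite_finite_induct) simp_all

section \<open>Infinite necklace products and ghost components\<close>

text \<open>For \<open>n > 0\<close>, the \<open>n\<close>-th ghost component of the necklace vector
  \<open>a\<close>.\<close>

definition divisor_sum :: "(nat \<Rightarrow> complex) \<Rightarrow> nat \<Rightarrow> complex" where
  "divisor_sum a n = (\<Sum>i | i dvd n. of_nat i * a i)"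

text \<open>The common form of both logarithmic derivatives: \<open>c\<close> consists of the values
  of the Adams operations for \<lambda>_t, and of the ghost components for the product.\<close>

definition signed_fps :: "(nat \<Rightarrow> complex) \<Rightarrow> complex fps" where
  "signed_fps c = Abs_fps (\<lambda>n. if n > 0 then - ((-1) ^ n * c n) else 0)"

lemma signed_fps_nth: "signed_fps c $ n = (if n > 0 then - ((-1) ^ n * c n) else 0)"
  by (simp add: signed_fps_def)

lemma sum_necklace_log_nth:
  assumes "finite I"
  shows "(\<Sum>i\<in>I. necklace_log i (a i)) $ n =
    (if n > 0 then - ((-1) ^ n * (\<Sum>i\<in>I \<inter> {i. i dvd n}. of_nat i * a i)) else 0)"
  using assms
  by (auto simp: fps_sum_nth necklace_log_nth sum_distrib_left sum_negf[symmetric] sum.If_cases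
      intro!: sum.cong)

lemma sum_necklace_log_nth_initial:
  assumes "n \<le> m"
  shows "(\<Sum>i=1..m. necklace_log i (a i)) $ n = signed_fps (divisor_sum a) $ n"
proof -
  have "{1..m} \<inter> {i. i dvd n} = {i. i dvd n}" if "n > 0"
    using that assms by (auto intro: dvd_pos_nat order_trans[OF dvd_imp_le] simp: Suc_le_eq)
  then show ?thesis by (simp add: sum_necklace_log_nth signed_fps_nth divisor_sum_def)
qed

text \<open>The infinite product. Factor \<open>i\<close> is 1 up to terms of degree at least
  \<open>i\<close>, so the first \<open>n\<close> factors already fix the coefficient of degree
  \<open>n\<close>.\<close>

definition necklace_product :: "(nat \<Rightarrow> complex) \<Rightarrow> complex fps" where
  "necklace_product a = Abs_fps (\<lambda>n. (\<Prod>i=1..n. necklace_fps i (a i)) $ n)"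

lemma euler_deriv_factor_partial:
  "euler_deriv_factor (\<Prod>i=1..m. necklace_fps i (a i)) (\<Sum>i=1..m. necklace_log i (a i))"
  by (intro euler_deriv_factor_prod euler_deriv_factor_necklace) auto

text \<open>A factor with \<open>i > n\<close> adds nothing to the logarithmic derivative up to
  degree \<open>n\<close>, since no such \<open>i\<close> divides a positive number up to
  \<open>n\<close>.\<close>

lemma necklace_product_nth:
  assumes "n \<le> m"
  shows "(\<Prod>i=1..m. necklace_fps i (a i)) $ n = necklace_product a $ n"
proof -
  have "(\<Prod>i=1..m. necklace_fps i (a i)) $ n = (\<Prod>i=1..n. necklace_fps i (a i)) $ n"
    by (rule euler_deriv_factor_nth_cong[OF euler_deriv_factor_partial euler_deriv_factor_partial])
       (use assms in \<open>simp_all add: fps_prod_nth_0 sum_necklace_log_nth_initial signed_fps_nth del: One_nat_def\<close>)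
  then show ?thesis by (simp add: necklace_product_def)
qed

lemma necklace_product_nth_0 [simp]: "necklace_product a $ 0 = 1"
  by (simp add: necklace_product_def)

lemma euler_deriv_factor_necklace_product:
  "euler_deriv_factor (necklace_product a) (signed_fps (divisor_sum a))"
  unfolding euler_deriv_factor_def
proof (rule fps_ext)
  fix n
  let ?P = "\<Prod>i=1..n. necklace_fps i (a i)"
  have "(fps_X * fps_deriv (necklace_product a)) $ n = (fps_X * fps_deriv ?P) $ n"
    by (simp only: fps_X_mult_deriv_nth necklace_product_nth[OF order_refl])
  also have "\<dots> = (?P * (\<Sum>i=1..n. necklace_log i (a i))) $ n"
    using euler_deriv_factor_partial[where m = n] by (simp only: euler_deriv_factor_def)
  also have "\<dots> = (\<Sum>k=0..n. necklace_product a $ k * signed_fps (divisor_sum a) $ (n - k))"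
    unfolding fps_mult_nth
    by (intro sum.cong refl arg_cong2[where f = times] necklace_product_nth sum_necklace_log_nth_initial) auto
  also have "\<dots> = (necklace_product a * signed_fps (divisor_sum a)) $ n" by (rule fps_mult_nth[symmetric])
  finally show "(fps_X * fps_deriv (necklace_product a)) $ n = \<dots>" .
qed

text \<open>Equal series have equal logarithmic derivatives because the nonzero \<open>F\<close>
  cancels; conversely, the logarithmic derivative and the constant term 1 determine the
  series.\<close>

lemma eq_necklace_product_iff:
  assumes "euler_deriv_factor F (signed_fps c)" "F $ 0 = 1"
  shows "F = necklace_product a \<longleftrightarrow> (\<forall>n>0. c n = divisor_sum a n)"
proof
  assume "F = necklace_product a"
  then have "F * signed_fps c = F * signed_fps (divisor_sum a)"
    using assms(1) euler_deriv_factor_necklace_product[of a] by (simp add: euler_deriv_factor_def)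
  moreover have "F \<noteq> 0" using assms(2) by auto
  ultimately have "signed_fps c = signed_fps (divisor_sum a)" by simp
  then have eq: "signed_fps c $ n = signed_fps (divisor_sum a) $ n" for n by simp
  show "\<forall>n>0. c n = divisor_sum a n"
  proof (intro allI impI)
    fix n :: nat assume "n > 0"
    then show "c n = divisor_sum a n" using eq[of n] by (simp add: signed_fps_nth)
  qed
next
  assume "\<forall>n>0. c n = divisor_sum a n"
  then have "signed_fps c = signed_fps (divisor_sum a)" by (auto simp: fps_eq_iff signed_fps_nth)
  then show "F = necklace_product a"
    using assms by (intro euler_deriv_factor_unique[OF assms(1)])
      (simp_all add: euler_deriv_factor_necklace_product signed_fps_nth)
qed

text \<open>Both sides have constant term 1, and their logarithmic derivatives agree because the
  omitted exponents vanish.\<close>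

lemma necklace_product_finite:
  assumes "e > 0" "\<And>n. n > 0 \<Longrightarrow> \<not> n dvd e \<Longrightarrow> a n = 0"
  shows "necklace_product a = (\<Prod>d | d dvd e. necklace_fps d (a d))"
proof (rule euler_deriv_factor_unique[OF euler_deriv_factor_necklace_product])
  have pos: "d > 0" if "d dvd e" for d using that assms(1) by (cases d) auto
  have fin: "finite {d. d dvd e}" using assms(1) by simp
  have "(\<Sum>d | d dvd e. necklace_log d (a d)) = signed_fps (divisor_sum a)"
  proof (rule fps_ext)
    fix n
    have "(\<Sum>i\<in>{d. d dvd e} \<inter> {i. i dvd n}. of_nat i * a i) = divisor_sum a n" if "n > 0"
      unfolding divisor_sum_def
      using assms(2) that by (intro sum.mono_neutral_left) (auto intro: Nat.gr0I)
    then show "(\<Sum>d | d dvd e. necklace_log d (a d)) $ n = signed_fps (divisor_sum a) $ n"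
      by (simp add: sum_necklace_log_nth[OF fin] signed_fps_nth)
  qed
  then show "euler_deriv_factor (\<Prod>d | d dvd e. necklace_fps d (a d)) (signed_fps (divisor_sum a))"
    using euler_deriv_factor_prod[OF fin, of "\<lambda>d. necklace_fps d (a d)" "\<lambda>d. necklace_log d (a d)"]
      euler_deriv_factor_necklace pos by simp
qed (simp_all add: fps_prod_nth_0 signed_fps_nth)

text \<open>Moebius inversion of \<^const>\<open>divisor_sum\<close>, by recursion over the proper divisors.\<close>

fun necklace :: "(nat \<Rightarrow> complex) \<Rightarrow> nat \<Rightarrow> complex" where
  "necklace c n = (c n - (\<Sum>i\<in>{i \<in> {1..<n}. i dvd n}. of_nat i * necklace c i)) / of_nat n"

declare necklace.simps [simp del]

lemma divisor_sum_split:
  assumes "n > 0"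
  shows "divisor_sum a n = of_nat n * a n + (\<Sum>i\<in>{i \<in> {1..<n}. i dvd n}. of_nat i * a i)"
proof -
  have "{i. i dvd n} = insert n {i \<in> {1..<n}. i dvd n}"
    using assms by (auto dest: dvd_imp_le intro: dvd_pos_nat simp: Suc_le_eq le_less)
  then show ?thesis by (simp add: divisor_sum_def)
qed

lemma divisor_sum_necklace:
  assumes "n > 0"
  shows "divisor_sum (necklace c) n = c n"
  using assms by (simp add: divisor_sum_split necklace.simps[of c n])

text \<open>The system is triangular: the \<open>n\<close>-th equation determines \<open>a n\<close>
  from the values at proper divisors of \<open>n\<close>.\<close>

lemma divisor_sum_inject:
  assumes "\<And>n. n > 0 \<Longrightarrow> divisor_sum a n = divisor_sum b n" "n > 0"
  shows "a n = b n"
  using assms(2)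
proof (induction n rule: less_induct)
  case (less n)
  have "(\<Sum>i\<in>{i \<in> {1..<n}. i dvd n}. of_nat i * a i) = (\<Sum>i\<in>{i \<in> {1..<n}. i dvd n}. of_nat i * b i)"
    using less.IH by (intro sum.cong) auto
  then show ?case
    using assms(1)[of n] less.prems by (simp add: divisor_sum_split)
qed

text \<open>Cutting \<open>a\<close> off outside the divisors of \<open>e\<close> gives a vector
  \<open>b\<close> whose ghost component at \<open>n\<close> is that of \<open>a\<close> at
  \<open>gcd n e\<close>. Hence the left side says that \<open>a\<close> and \<open>b\<close> have
  the same ghost components, that is, \<open>a = b\<close> at positive indices.\<close>

lemma divisor_sum_supported_iff:
  assumes "e > 0"
  shows "(\<forall>n>0. divisor_sum a n = divisor_sum a (gcd n e)) \<longleftrightarrow> (\<forall>n>0. \<not> n dvd e \<longrightarrow> a n = 0)"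
proof -
  define b where "b n = (if n dvd e then a n else 0)" for n
  have b: "divisor_sum b n = divisor_sum a (gcd n e)" if "n > 0" for n
  proof -
    have "divisor_sum b n = (\<Sum>i | i dvd gcd n e. of_nat i * b i)"
      unfolding divisor_sum_def using that by (intro sum.mono_neutral_right) (auto simp: b_def)
    also have "\<dots> = divisor_sum a (gcd n e)"
      unfolding divisor_sum_def by (intro sum.cong) (auto simp: b_def)
    finally show ?thesis .
  qed
  show ?thesis
  proof
    assume "\<forall>n>0. divisor_sum a n = divisor_sum a (gcd n e)"
    then have "divisor_sum a n = divisor_sum b n" if "n > 0" for n
      using that b by metis
    then have "a n = b n" if "n > 0" for n
      using that by (rule divisor_sum_inject)
    then show "\<forall>n>0. \<not> n dvd e \<longrightarrow> a n = 0" by (metis b_def)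
  next
    assume *: "\<forall>n>0. \<not> n dvd e \<longrightarrow> a n = 0"
    have "divisor_sum a n = divisor_sum b n" if "n > 0" for n
      unfolding divisor_sum_def b_def using * dvd_pos_nat[OF that] by (intro sum.cong) auto
    then show "\<forall>n>0. divisor_sum a n = divisor_sum a (gcd n e)" using b by metis
  qed
qed

section \<open>Traces of powers\<close>

lemma sum_list_diag_mat:
  "A \<in> carrier_mat n n \<Longrightarrow> sum_list (diag_mat A) = (\<Sum>i<n. A $$ (i, i))"
  by (auto simp: diag_mat_def sum_list_sum_nth lessThan_atLeast0)

lemma sum_list_diag_mat_mult_commute:
  fixes A B :: "'b :: comm_ring_1 mat"
  assumes A: "A \<in> carrier_mat n n" and B: "B \<in> carrier_mat n n"
  shows "sum_list (diag_mat (A * B)) = sum_list (diag_mat (B * A))"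
proof -
  have "sum_list (diag_mat (A * B)) = (\<Sum>i<n. \<Sum>j<n. A $$ (i, j) * B $$ (j, i))"
    using A B by (simp add: sum_list_diag_mat[of _ n] scalar_prod_def lessThan_atLeast0)
  also have "\<dots> = (\<Sum>j<n. \<Sum>i<n. B $$ (j, i) * A $$ (i, j))"
    by (subst sum.swap) (simp add: mult.commute)
  also have "\<dots> = sum_list (diag_mat (B * A))"
    using A B by (simp add: sum_list_diag_mat[of _ n] scalar_prod_def lessThan_atLeast0)
  finally show ?thesis .
qed

lemma sum_list_diag_mat_similar:
  fixes A B :: "'b :: comm_ring_1 mat"
  assumes "similar_mat_wit A B P Q"
  shows "sum_list (diag_mat A) = sum_list (diag_mat B)"
proof -
  obtain n where n: "n = dim_row A" by simp
  note w = similar_mat_witD[OF n assms]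
  have "sum_list (diag_mat A) = sum_list (diag_mat (P * (B * Q)))"
    using w by (simp add: assoc_mult_mat[of _ n n _ n _ n])
  also have "\<dots> = sum_list (diag_mat (B * Q * P))"
    using w by (intro sum_list_diag_mat_mult_commute[of _ n]) auto
  also have "B * Q * P = B"
    using w by (simp add: assoc_mult_mat[of _ n n _ n _ n])
  finally show ?thesis .
qed

lemma upper_triangular_mult:
  fixes A B :: "'b :: comm_ring_1 mat"
  assumes A: "A \<in> carrier_mat n n" "upper_triangular A" and B: "B \<in> carrier_mat n n" "upper_triangular B"
  shows "upper_triangular (A * B)" "\<And>i. i < n \<Longrightarrow> (A * B) $$ (i, i) = A $$ (i, i) * B $$ (i, i)"
proof -
  have A0: "A $$ (i, j) = 0" if "j < i" "i < n" for i j using A that by auto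
  have B0: "B $$ (i, j) = 0" if "j < i" "i < n" for i j using B that by auto
  have entry: "(A * B) $$ (i, j) = (\<Sum>k<n. A $$ (i, k) * B $$ (k, j))" if "i < n" "j < n" for i j
    using A B that by (simp add: scalar_prod_def lessThan_atLeast0)
  show "upper_triangular (A * B)"
  proof (rule upper_triangularI)
    fix i j assume ij: "j < i" "i < dim_row (A * B)"
    then have "(A * B) $$ (i, j) = (\<Sum>k<n. A $$ (i, k) * B $$ (k, j))" using A by (intro entry) auto
    also have "\<dots> = 0"
    proof (intro sum.neutral ballI)
      fix k assume "k \<in> {..<n}"
      then show "A $$ (i, k) * B $$ (k, j) = 0"
        using A0[of k i] B0[of j k] ij A by (cases "k < i") auto
    qed
    finally show "(A * B) $$ (i, j) = 0" .
  qed
  fix i assume i: "i < n"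
  have "(\<Sum>k<n. A $$ (i, k) * B $$ (k, i)) = (\<Sum>k\<in>{i}. A $$ (i, k) * B $$ (k, i))"
  proof (rule sum.mono_neutral_right)
    show "\<forall>k\<in>{..<n} - {i}. A $$ (i, k) * B $$ (k, i) = 0"
    proof
      fix k assume "k \<in> {..<n} - {i}"
      then show "A $$ (i, k) * B $$ (k, i) = 0"
        using A0[of k i] B0[of i k] i by (cases "k < i") auto
    qed
  qed (use i in auto)
  then show "(A * B) $$ (i, i) = A $$ (i, i) * B $$ (i, i)" using entry[OF i i] by simp
qed

lemma upper_triangular_pow:
  fixes A :: "'b :: comm_ring_1 mat"
  assumes A: "A \<in> carrier_mat n n" "upper_triangular A"
  shows "upper_triangular (A ^\<^sub>m k) \<and> (\<forall>i<n. (A ^\<^sub>m k) $$ (i, i) = A $$ (i, i) ^ k)"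
proof (induction k)
  case 0
  then show ?case using A by simp
next
  case (Suc k)
  have "A ^\<^sub>m k \<in> carrier_mat n n" using A(1) by (rule pow_carrier_mat)
  then show ?case using upper_triangular_mult[of "A ^\<^sub>m k" n A] A Suc by simp
qed

text \<open>Triangularization suffices: if \<open>A\<close> is similar to an upper triangular
  \<open>B\<close>, the diagonal of a power of \<open>B\<close> consists of the powers of its
  diagonal entries, and these serve as \<open>w\<close>. Moreover \<open>B ^\<^sub>m e\<close> is
  similar to the identity, hence equal to it.\<close>

lemma sum_list_diag_mat_pow:
  fixes A :: "complex mat"
  assumes A: "A \<in> carrier_mat n n" and "A ^\<^sub>m e = 1\<^sub>m n"
  obtains w where "\<And>i. i < n \<Longrightarrow> w i ^ e = 1"
    and "\<And>k. sum_list (diag_mat (A ^\<^sub>m k)) = (\<Sum>i<n. w i ^ k)"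
proof -
  obtain es where "char_poly A = (\<Prod>a\<leftarrow>es. [:- a, 1:])" using char_poly_factorized[OF A] by blast
  then obtain B where B: "B \<in> carrier_mat n n" "upper_triangular B" "similar_mat A B"
    using schur_decomposition_exists[OF A] by blast
  obtain P Q where wit: "similar_mat_wit A B P Q" using B(3) by (auto simp: similar_mat_def)
  note wit_pow = similar_mat_wit_pow[OF wit]
  note pow = upper_triangular_pow[OF B(1,2)]
  show ?thesis
  proof (rule that)
    fix k
    have "sum_list (diag_mat (A ^\<^sub>m k)) = sum_list (diag_mat (B ^\<^sub>m k))"
      by (rule sum_list_diag_mat_similar[OF wit_pow])
    also have "\<dots> = (\<Sum>i<n. B $$ (i, i) ^ k)"
      using pow[of k] by (simp add: sum_list_diag_mat[OF pow_carrier_mat[OF B(1)]])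
    finally show "sum_list (diag_mat (A ^\<^sub>m k)) = (\<Sum>i<n. B $$ (i, i) ^ k)" .
  next
    fix i assume i: "i < n"
    have "similar_mat_wit (B ^\<^sub>m e) (1\<^sub>m n) Q P"
      using similar_mat_wit_sym[OF wit_pow[of e]] assms(2) by simp
    note w = similar_mat_witD2[OF pow_carrier_mat[OF B(1)] this]
    have "B ^\<^sub>m e = Q * P" using w by simp
    then have "B ^\<^sub>m e = 1\<^sub>m n" using w by simp
    then show "B $$ (i, i) ^ e = 1" using pow[of e] i by (metis index_one_mat(1))
  qed
qed

section \<open>Characters as class functions and as sums of roots of unity\<close>

context
  fixes G :: "('a, 'm) monoid_scheme" (structure)
    and n :: nat and \<rho> :: "'a \<Rightarrow> complex mat"
  assumes group: "group G" and rep: "representation G n \<rho>"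
begin

interpretation group G by (rule group)

lemma representation_carrier: "g \<in> carrier G \<Longrightarrow> \<rho> g \<in> carrier_mat n n"
  using rep by (auto simp: representation_def hom_def units_of_def Units_def ring_mat_def)

lemma representation_mult:
  "g \<in> carrier G \<Longrightarrow> h \<in> carrier G \<Longrightarrow> \<rho> (g \<otimes> h) = \<rho> g * \<rho> h"
  using rep by (auto simp: representation_def hom_def units_of_def ring_mat_def)

lemma representation_one: "\<rho> \<one> = 1\<^sub>m n"
proof -
  interpret R: ring "ring_mat TYPE(complex) n ()" by (rule ring_mat)
  have "group (units_of (ring_mat TYPE(complex) n ()))" by (rule R.units_group)
  then have "\<rho> \<one> = \<one>\<^bsub>units_of (ring_mat TYPE(complex) n ())\<^esub>"
    using rep group by (intro hom_one) (simp_all add: representation_def)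
  then show ?thesis by (simp add: units_of_def ring_mat_def)
qed

lemma representation_pow: "g \<in> carrier G \<Longrightarrow> \<rho> (g [^] k) = \<rho> g ^\<^sub>m k" for k :: nat
proof (induction k)
  case 0
  then show ?case using representation_carrier[of g] by (simp add: representation_one)
next
  case (Suc k)
  then show ?case by (simp add: representation_mult)
qed

text \<open>Under the trace, \<open>\<rho> (inv y)\<close> may be moved to the front, where it
  cancels \<open>y\<close>.\<close>

lemma character_conj:
  assumes "x \<in> carrier G" "y \<in> carrier G"
  shows "character G \<rho> (y \<otimes> x \<otimes> inv y) = character G \<rho> x"
proof -
  note c = representation_carrier
  have "\<rho> (y \<otimes> x \<otimes> inv y) = \<rho> (y \<otimes> x) * \<rho> (inv y)"
    using assms by (intro representation_mult) auto
  then have "character G \<rho> (y \<otimes> x \<otimes> inv y) = sum_list (diag_mat (\<rho> (y \<otimes> x) * \<rho> (inv y)))"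
    using assms by (simp add: character_def)
  also have "\<dots> = sum_list (diag_mat (\<rho> (inv y) * \<rho> (y \<otimes> x)))"
    using assms by (intro sum_list_diag_mat_mult_commute[of _ n] c) auto
  also have "\<rho> (inv y) * \<rho> (y \<otimes> x) = \<rho> (inv y \<otimes> (y \<otimes> x))"
    using assms by (intro representation_mult[symmetric]) auto
  also have "inv y \<otimes> (y \<otimes> x) = x" using assms by (simp add: m_assoc[symmetric])
  finally show ?thesis using assms by (simp add: character_def)
qed

lemma root_sum_character:
  assumes "g \<in> carrier G" "g [^] e = \<one>" "e > 0"
  shows "root_sum e (\<lambda>k. character G \<rho> (g [^] k))"
proof -
  have "\<rho> g ^\<^sub>m e = 1\<^sub>m n"
    using assms by (simp add: representation_pow[symmetric] representation_one)
  then obtain w where w: "\<And>i. i < n \<Longrightarrow> w i ^ e = 1"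
      "\<And>k. sum_list (diag_mat (\<rho> g ^\<^sub>m k)) = (\<Sum>i<n. w i ^ k)"
    using sum_list_diag_mat_pow[OF representation_carrier[OF assms(1)]] by blast
  have "root_sum e (\<lambda>k. \<Sum>i<n. w i ^ k)"
    using w(1) assms(3) by (intro root_sum_sum root_sum_power) auto
  then show ?thesis using w(2) assms(1) by (simp add: character_def representation_pow)
qed

end

lemma (in group) pow_exponent:
  assumes "finite (carrier G)" "g \<in> carrier G"
  shows "g [^] exponent G = \<one>"
proof -
  have "ord g dvd exponent G" using assms(2) by (simp add: exponent_def)
  then show ?thesis using assms(2) pow_eq_id by blast
qed

lemma (in group) exponent_pos:
  assumes "finite (carrier G)"
  shows "exponent G > 0"
proof -
  have "0 \<notin> ord ` carrier G" using assms ord_ge_1 by fastforce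
  then have "exponent G \<noteq> 0" using assms by (simp add: exponent_def Lcm_0_iff)
  then show ?thesis by simp
qed

lemma virtual_character_conj:
  assumes "group G" "\<chi> \<in> virtual_characters G" "x \<in> carrier G" "y \<in> carrier G"
  shows "\<chi> (y \<otimes>\<^bsub>G\<^esub> x \<otimes>\<^bsub>G\<^esub> inv\<^bsub>G\<^esub> y) = \<chi> x"
proof -
  interpret group G by fact
  obtain S and c :: "_ \<Rightarrow> int" where S: "S \<subseteq> irreducible_characters G"
    and \<chi>: "\<chi> = (\<lambda>g\<in>carrier G. \<Sum>\<phi>\<in>S. of_int (c \<phi>) * \<phi> g)"
    using assms(2) by (auto simp: virtual_characters_def)
  have "\<phi> (y \<otimes>\<^bsub>G\<^esub> x \<otimes>\<^bsub>G\<^esub> inv\<^bsub>G\<^esub> y) = \<phi> x" if "\<phi> \<in> S" for \<phi>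
    using S that assms character_conj
    by (fastforce simp: irreducible_characters_def irreducible_representation_def)
  then have "(\<Sum>\<phi>\<in>S. of_int (c \<phi>) * \<phi> (y \<otimes>\<^bsub>G\<^esub> x \<otimes>\<^bsub>G\<^esub> inv\<^bsub>G\<^esub> y)) = (\<Sum>\<phi>\<in>S. of_int (c \<phi>) * \<phi> x)"
    by (intro sum.cong) auto
  then show ?thesis using assms by (simp add: \<chi>)
qed

lemma root_sum_virtual_character:
  assumes "group G" "finite (carrier G)" "\<chi> \<in> virtual_characters G" "g \<in> carrier G"
  shows "root_sum (exponent G) (\<lambda>k. \<chi> (g [^]\<^bsub>G\<^esub> k))"
proof -
  interpret group G by fact
  obtain S and c :: "_ \<Rightarrow> int" where S: "S \<subseteq> irreducible_characters G"
    and \<chi>: "\<chi> = (\<lambda>g\<in>carrier G. \<Sum>\<phi>\<in>S. of_int (c \<phi>) * \<phi> g)"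
    using assms(3) by (auto simp: virtual_characters_def)
  have "root_sum (exponent G) (\<lambda>k. \<phi> (g [^]\<^bsub>G\<^esub> k))" if \<phi>: "\<phi> \<in> S" for \<phi>
  proof -
    obtain n \<rho> where "representation G n \<rho>" "\<phi> = character G \<rho>"
      using S \<phi> unfolding irreducible_characters_def irreducible_representation_def by blast
    then show ?thesis
      using root_sum_character[OF assms(1) _ assms(4)] pow_exponent exponent_pos assms by blast
  qed
  then have "root_sum (exponent G) (\<lambda>k. \<Sum>\<phi>\<in>S. of_int (c \<phi>) * \<phi> (g [^]\<^bsub>G\<^esub> k))"
    by (intro root_sum_sum root_sum_scale)
  then show ?thesis using assms(4) by (simp add: \<chi>)
qed

section \<open>Power series over the ring of class functions\<close>

lemma ps_lim_eq:
  assumes "\<And>m. m \<ge> N \<Longrightarrow> F m n = c"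
  shows "ps_lim F n = c"
proof -
  have ev: "\<forall>\<^sub>F m in sequentially. F m n = c"
    using assms unfolding eventually_sequentially by blast
  moreover have "d = c" if "\<forall>\<^sub>F m in sequentially. F m n = d" for d
  proof -
    have "\<forall>\<^sub>F m in sequentially. d = c" using that ev by eventually_elim simp
    then show ?thesis by simp
  qed
  ultimately show ?thesis unfolding ps_lim_def by (rule the_equality)
qed

section \<open>Class functions and their evaluation at group elements\<close>

context
  fixes G :: "('a, 'm) monoid_scheme"
  assumes group_G: "group G"
begin

interpretation group G by (rule group_G)

lemma CF_closed_iff:
  "f \<in> carrier (CF G) \<longleftrightarrow> f \<in> extensional (carrier G) \<and>
    (\<forall>x\<in>carrier G. \<forall>y\<in>carrier G. f (y \<otimes>\<^bsub>G\<^esub> x \<otimes>\<^bsub>G\<^esub> inv\<^bsub>G\<^esub> y) = f x)"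
  by (simp add: CF_def)

lemma CF_restrictI:
  "(\<And>x y. x \<in> carrier G \<Longrightarrow> y \<in> carrier G \<Longrightarrow> f (y \<otimes>\<^bsub>G\<^esub> x \<otimes>\<^bsub>G\<^esub> inv\<^bsub>G\<^esub> y) = f x) \<Longrightarrow>
    restrict f (carrier G) \<in> carrier (CF G)"
  by (simp add: CF_closed_iff)

lemma CF_eqI:
  "f \<in> carrier (CF G) \<Longrightarrow> h \<in> carrier (CF G) \<Longrightarrow> (\<And>g. g \<in> carrier G \<Longrightarrow> f g = h g) \<Longrightarrow> f = h"
  by (auto simp: CF_closed_iff intro: extensionalityI)

lemma CF_simps:
  "f \<otimes>\<^bsub>CF G\<^esub> h = (\<lambda>g\<in>carrier G. f g * h g)"
  "f \<oplus>\<^bsub>CF G\<^esub> h = (\<lambda>g\<in>carrier G. f g + h g)"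
  "\<one>\<^bsub>CF G\<^esub> = (\<lambda>g\<in>carrier G. 1)"
  "\<zero>\<^bsub>CF G\<^esub> = (\<lambda>g\<in>carrier G. 0)"
  by (simp_all add: CF_def)

lemma CF_closed:
  "f \<in> carrier (CF G) \<Longrightarrow> h \<in> carrier (CF G) \<Longrightarrow> f \<otimes>\<^bsub>CF G\<^esub> h \<in> carrier (CF G)"
  "f \<in> carrier (CF G) \<Longrightarrow> h \<in> carrier (CF G) \<Longrightarrow> f \<oplus>\<^bsub>CF G\<^esub> h \<in> carrier (CF G)"
  "\<one>\<^bsub>CF G\<^esub> \<in> carrier (CF G)" "\<zero>\<^bsub>CF G\<^esub> \<in> carrier (CF G)"
  by (auto simp: CF_simps intro!: CF_restrictI) (simp_all add: CF_closed_iff)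

lemma CF_cring: "cring (CF G)"
proof (intro cringI abelian_groupI comm_monoidI)
  fix x assume x: "x \<in> carrier (CF G)"
  show "\<exists>y\<in>carrier (CF G). y \<oplus>\<^bsub>CF G\<^esub> x = \<zero>\<^bsub>CF G\<^esub>"
  proof (rule bexI)
    show "(\<lambda>g\<in>carrier G. - x g) \<in> carrier (CF G)"
      using x by (intro CF_restrictI) (simp add: CF_closed_iff)
  qed (auto simp: CF_simps)
qed (auto simp: CF_closed intro!: CF_eqI, auto simp: CF_simps algebra_simps)

interpretation CF: cring "CF G" by (rule CF_cring)

context
  fixes g assumes g: "g \<in> carrier G"
begin

lemma CF_eval_simps:
  "(f \<otimes>\<^bsub>CF G\<^esub> h) g = f g * h g" "(f \<oplus>\<^bsub>CF G\<^esub> h) g = f g + h g"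
  "\<one>\<^bsub>CF G\<^esub> g = 1" "\<zero>\<^bsub>CF G\<^esub> g = 0"
  using g by (simp_all add: CF_simps)

lemma CF_eval_uminus:
  assumes "f \<in> carrier (CF G)"
  shows "(\<ominus>\<^bsub>CF G\<^esub> f) g = - f g"
proof -
  have "(f \<oplus>\<^bsub>CF G\<^esub> \<ominus>\<^bsub>CF G\<^esub> f) g = \<zero>\<^bsub>CF G\<^esub> g" using assms by (simp add: CF.r_neg)
  then show ?thesis by (simp add: CF_eval_simps add_eq_0_iff)
qed

lemma CF_eval_power: "f \<in> carrier (CF G) \<Longrightarrow> (f [^]\<^bsub>CF G\<^esub> (n::nat)) g = f g ^ n"
  by (induction n) (simp_all add: CF_eval_simps)

lemma CF_eval_finsum:
  "F \<in> I \<rightarrow> carrier (CF G) \<Longrightarrow> (\<Oplus>\<^bsub>CF G\<^esub>i\<in>I. F i) g = (\<Sum>i\<in>I. F i g)"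
  by (induction I rule: infinite_finite_induct) (simp_all add: CF_eval_simps Pi_iff)

lemma CF_eval_finprod:
  "F \<in> I \<rightarrow> carrier (CF G) \<Longrightarrow> (\<Otimes>\<^bsub>CF G\<^esub>i\<in>I. F i) g = (\<Prod>i\<in>I. F i g)"
  by (induction I rule: infinite_finite_induct) (simp_all add: CF_eval_simps Pi_iff)

lemma CF_eval_of_nat: "([n] \<cdot>\<^bsub>CF G\<^esub> \<one>\<^bsub>CF G\<^esub>) g = of_nat n" for n :: nat
  by (induction n) (simp_all add: CF_eval_simps CF.add.nat_pow_0 CF.add.nat_pow_Suc)

end

lemma CF_recip:
  assumes "n > 0"
  shows "recip (CF G) n = (\<lambda>g\<in>carrier G. 1 / of_nat n)"
  unfolding recip_def
proof (rule CF.comm_inv_char)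
  show inv: "(\<lambda>g\<in>carrier G. 1 / of_nat n) \<in> carrier (CF G)" by (rule CF_restrictI) simp
  show "[n] \<cdot>\<^bsub>CF G\<^esub> \<one>\<^bsub>CF G\<^esub> \<otimes>\<^bsub>CF G\<^esub> (\<lambda>g\<in>carrier G. 1 / of_nat n) = \<one>\<^bsub>CF G\<^esub>"
    using assms inv by (intro CF_eqI) (simp_all add: CF_eval_simps CF_eval_of_nat)
qed simp

lemma CF_recip_closed: "n > 0 \<Longrightarrow> recip (CF G) n \<in> carrier (CF G)"
  by (simp add: CF_recip CF_restrictI)

lemma CF_binom_closed: "a \<in> carrier (CF G) \<Longrightarrow> binom (CF G) a k \<in> carrier (CF G)"
  unfolding binom_def by (intro CF.m_closed CF.finprod_closed CF_recip_closed) auto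

lemma CF_eval_binom:
  assumes "g \<in> carrier G" "a \<in> carrier (CF G)"
  shows "binom (CF G) a k g = (a g gchoose k)"
proof -
  have "binom (CF G) a k g = (\<Prod>j<k. a g - of_nat j) / fact k"
    unfolding binom_def using assms
    by (simp add: CF_eval_simps CF_eval_finprod CF_recip a_minus_def CF_eval_uminus CF_eval_of_nat)
  then show ?thesis by (simp add: gbinomial_prod_rev lessThan_atLeast0)
qed

section \<open>Power series over class functions, evaluated coefficientwise\<close>

definition eval_ps :: "'a \<Rightarrow> (nat \<Rightarrow> 'a \<Rightarrow> complex) \<Rightarrow> complex fps" where
  "eval_ps g F = Abs_fps (\<lambda>n. F n g)"

lemma eval_ps_nth [simp]: "eval_ps g F $ n = F n g"
  by (simp add: eval_ps_def)

lemma PS_closed_iff: "F \<in> carrier (PS (CF G)) \<longleftrightarrow> (\<forall>n. F n \<in> carrier (CF G))"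
  by (auto simp: PS_def)

text \<open>The evaluations at elements of the group are jointly injective, so identities over CF(G)
  can be checked among complex power series.\<close>

lemma PS_eqI:
  assumes "F \<in> carrier (PS (CF G))" "H \<in> carrier (PS (CF G))"
    and "\<And>g. g \<in> carrier G \<Longrightarrow> eval_ps g F = eval_ps g H"
  shows "F = H"
proof
  fix n
  show "F n = H n"
  proof (rule CF_eqI)
    fix g assume "g \<in> carrier G"
    from assms(3)[OF this] have "eval_ps g F $ n = eval_ps g H $ n" by simp
    then show "F n g = H n g" by simp
  qed (use assms in \<open>auto simp: PS_closed_iff\<close>)
qed

lemma PS_closed:
  "F \<in> carrier (PS (CF G)) \<Longrightarrow> H \<in> carrier (PS (CF G)) \<Longrightarrow> F \<otimes>\<^bsub>PS (CF G)\<^esub> H \<in> carrier (PS (CF G))"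
  "F \<in> carrier (PS (CF G)) \<Longrightarrow> H \<in> carrier (PS (CF G)) \<Longrightarrow> F \<oplus>\<^bsub>PS (CF G)\<^esub> H \<in> carrier (PS (CF G))"
  "\<one>\<^bsub>PS (CF G)\<^esub> \<in> carrier (PS (CF G))" "\<zero>\<^bsub>PS (CF G)\<^esub> \<in> carrier (PS (CF G))"
  by (auto simp: PS_def intro!: CF.finsum_closed)

lemma eval_ps_simps:
  assumes "g \<in> carrier G"
  shows "F \<in> carrier (PS (CF G)) \<Longrightarrow> H \<in> carrier (PS (CF G)) \<Longrightarrow>
      eval_ps g (F \<otimes>\<^bsub>PS (CF G)\<^esub> H) = eval_ps g F * eval_ps g H"
    and "eval_ps g (F \<oplus>\<^bsub>PS (CF G)\<^esub> H) = eval_ps g F + eval_ps g H"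
    and "eval_ps g \<one>\<^bsub>PS (CF G)\<^esub> = 1"
    and "eval_ps g \<zero>\<^bsub>PS (CF G)\<^esub> = 0"
proof -
  assume "F \<in> carrier (PS (CF G))" "H \<in> carrier (PS (CF G))"
  then have "(\<lambda>i. F i \<otimes>\<^bsub>CF G\<^esub> H (n - i)) \<in> {..n} \<rightarrow> carrier (CF G)" for n
    by (auto simp: PS_closed_iff)
  from CF_eval_finsum[OF assms this]
  show "eval_ps g (F \<otimes>\<^bsub>PS (CF G)\<^esub> H) = eval_ps g F * eval_ps g H"
    using assms by (intro fps_ext) (simp add: PS_def fps_mult_nth CF_eval_simps atMost_atLeast0)
qed (use assms in \<open>auto simp: fps_eq_iff PS_def CF_eval_simps\<close>)

text \<open>The ring laws are inherited from complex power series, as \<open>eval_ps g\<close>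
  respects the operations.\<close>

lemma PS_cring: "cring (PS (CF G))"
proof (intro cringI abelian_groupI comm_monoidI)
  fix x assume x: "x \<in> carrier (PS (CF G))"
  show "\<exists>y\<in>carrier (PS (CF G)). y \<oplus>\<^bsub>PS (CF G)\<^esub> x = \<zero>\<^bsub>PS (CF G)\<^esub>"
  proof (rule bexI)
    show "(\<lambda>n. \<ominus>\<^bsub>CF G\<^esub> x n) \<in> carrier (PS (CF G))" using x by (simp add: PS_closed_iff)
    show "(\<lambda>n. \<ominus>\<^bsub>CF G\<^esub> x n) \<oplus>\<^bsub>PS (CF G)\<^esub> x = \<zero>\<^bsub>PS (CF G)\<^esub>"
    proof
      fix n
      have "x n \<in> carrier (CF G)" using x by (simp add: PS_closed_iff)
      then show "((\<lambda>n. \<ominus>\<^bsub>CF G\<^esub> x n) \<oplus>\<^bsub>PS (CF G)\<^esub> x) n = \<zero>\<^bsub>PS (CF G)\<^esub> n"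
        by (simp add: PS_def CF.l_neg)
    qed
  qed
qed (auto simp: PS_closed intro!: PS_eqI, auto simp: PS_closed eval_ps_simps algebra_simps)

interpretation PS: cring "PS (CF G)" by (rule PS_cring)

context
  fixes g assumes g: "g \<in> carrier G"
begin

lemma eval_ps_uminus:
  assumes "F \<in> carrier (PS (CF G))"
  shows "eval_ps g (\<ominus>\<^bsub>PS (CF G)\<^esub> F) = - eval_ps g F"
proof -
  have "eval_ps g (F \<oplus>\<^bsub>PS (CF G)\<^esub> \<ominus>\<^bsub>PS (CF G)\<^esub> F) = eval_ps g \<zero>\<^bsub>PS (CF G)\<^esub>"
    using assms by (simp add: PS.r_neg)
  then show ?thesis by (simp add: eval_ps_simps[OF g] add_eq_0_iff)
qed

lemma eval_ps_power:
  "F \<in> carrier (PS (CF G)) \<Longrightarrow> eval_ps g (F [^]\<^bsub>PS (CF G)\<^esub> (n::nat)) = eval_ps g F ^ n"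
  by (induction n) (simp_all add: eval_ps_simps[OF g])

lemma eval_ps_finsum:
  "F \<in> I \<rightarrow> carrier (PS (CF G)) \<Longrightarrow>
    eval_ps g (\<Oplus>\<^bsub>PS (CF G)\<^esub>i\<in>I. F i) = (\<Sum>i\<in>I. eval_ps g (F i))"
  by (induction I rule: infinite_finite_induct) (simp_all add: eval_ps_simps[OF g] Pi_iff)

lemma eval_ps_finprod:
  "F \<in> I \<rightarrow> carrier (PS (CF G)) \<Longrightarrow>
    eval_ps g (\<Otimes>\<^bsub>PS (CF G)\<^esub>i\<in>I. F i) = (\<Prod>i\<in>I. eval_ps g (F i))"
  by (induction I rule: infinite_finite_induct) (simp_all add: eval_ps_simps[OF g] Pi_iff)

end

section \<open>Necklace products and exponentials over class functions\<close>

lemma necklace_factor_closed: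
  assumes "a \<in> carrier (CF G)"
  shows "necklace_factor (CF G) i a \<in> carrier (PS (CF G))"
  unfolding necklace_factor_def ps_subst_def one_minus_pow_def PS_closed_iff
  using assms by (auto intro!: CF.m_closed CF_binom_closed)

lemma eval_ps_necklace_factor:
  assumes "g \<in> carrier G" "a \<in> carrier (CF G)" "i > 0"
  shows "eval_ps g (necklace_factor (CF G) i a) = necklace_fps i (a g)"
proof (rule fps_ext)
  fix n
  show "eval_ps g (necklace_factor (CF G) i a) $ n = necklace_fps i (a g) $ n"
    unfolding necklace_fps_nth[OF assms(3)] using assms
    by (simp add: necklace_factor_def ps_subst_def one_minus_pow_def
        CF_eval_simps CF_eval_power CF_eval_uminus CF_eval_binom)
qed

lemma Nr_closed_iff:
  "a \<in> carrier (Nr (CF G)) \<longleftrightarrow> a \<in> extensional {1..} \<and> (\<forall>i>0. a i \<in> carrier (CF G))"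
  by (auto simp: Nr_def PiE_iff Suc_le_eq)

lemma necklace_partial_closed:
  assumes "a \<in> carrier (Nr (CF G))"
  shows "(\<Otimes>\<^bsub>PS (CF G)\<^esub>i\<in>{1..m}. necklace_factor (CF G) i (a i)) \<in> carrier (PS (CF G))"
  using assms by (intro PS.finprod_closed) (auto simp: Nr_closed_iff intro!: necklace_factor_closed)

lemma eval_ps_necklace_partial:
  assumes "g \<in> carrier G" "a \<in> carrier (Nr (CF G))"
  shows "eval_ps g (\<Otimes>\<^bsub>PS (CF G)\<^esub>i\<in>{1..m}. necklace_factor (CF G) i (a i)) =
    (\<Prod>i=1..m. necklace_fps i (a i g))"
proof -
  have "(\<lambda>i. necklace_factor (CF G) i (a i)) \<in> {1..m} \<rightarrow> carrier (PS (CF G))"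
    using assms(2) by (auto simp: Nr_closed_iff intro!: necklace_factor_closed)
  note eval_ps_finprod[OF assms(1) this]
  also have "(\<Prod>i=1..m. eval_ps g (necklace_factor (CF G) i (a i))) = (\<Prod>i=1..m. necklace_fps i (a i g))"
    using assms by (intro prod.cong refl eval_ps_necklace_factor) (auto simp: Nr_closed_iff)
  finally show ?thesis .
qed

text \<open>The coefficient of degree \<open>n\<close> is the same in all partial products with
  \<open>m \<ge> n\<close>, so \<open>ps_lim\<close> takes it from the \<open>n\<close>-th
  one.\<close>

lemma necklace_limit:
  assumes "a \<in> carrier (Nr (CF G))"
  defines "P \<equiv> ps_lim (\<lambda>m. \<Otimes>\<^bsub>PS (CF G)\<^esub>i\<in>{1..m}. necklace_factor (CF G) i (a i))"
  shows "P \<in> carrier (PS (CF G))"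
    and "\<And>g. g \<in> carrier G \<Longrightarrow> eval_ps g P = necklace_product (\<lambda>i. a i g)"
proof -
  let ?Q = "\<lambda>m. \<Otimes>\<^bsub>PS (CF G)\<^esub>i\<in>{1..m}. necklace_factor (CF G) i (a i)"
  have Q: "?Q m \<in> carrier (PS (CF G))" for m by (rule necklace_partial_closed[OF assms(1)])
  have Qg: "?Q m n g = necklace_product (\<lambda>i. a i g) $ n" if "n \<le> m" "g \<in> carrier G" for m n g
    using eval_ps_necklace_partial[OF that(2) assms(1), of m] necklace_product_nth[OF that(1)]
    by (metis eval_ps_nth)
  have P: "P n = ?Q n n" for n
    unfolding P_def
  proof (rule ps_lim_eq)
    fix m assume "n \<le> m"
    then show "?Q m n = ?Q n n"
      using Q Qg[of n m] Qg[of n n] by (intro CF_eqI) (auto simp: PS_closed_iff)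
  qed
  show "P \<in> carrier (PS (CF G))" using Q by (auto simp: PS_closed_iff P)
  show "eval_ps g P = necklace_product (\<lambda>i. a i g)" if "g \<in> carrier G" for g
    using Qg[OF order_refl that] by (intro fps_ext) (simp add: P)
qed

text \<open>As \<open>h\<close> has no constant term, \<open>h\<close> to the power \<open>k\<close>
  starts in degree \<open>k\<close>; so the coefficient of degree \<open>n\<close> is stable from
  \<open>m = n\<close> on.\<close>

lemma PS_exp:
  assumes h: "h \<in> carrier (PS (CF G))" "h 0 = \<zero>\<^bsub>CF G\<^esub>"
  shows "ps_exp (CF G) h \<in> carrier (PS (CF G))"
    and "\<And>g. g \<in> carrier G \<Longrightarrow> eval_ps g (ps_exp (CF G) h) = fps_exp 1 oo eval_ps g h"
proof -
  let ?T = "\<lambda>k. ps_const (CF G) (recip (CF G) (fact k)) \<otimes>\<^bsub>PS (CF G)\<^esub> (h [^]\<^bsub>PS (CF G)\<^esub> k)"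
  let ?Q = "\<lambda>m. \<Oplus>\<^bsub>PS (CF G)\<^esub>k\<in>{..m}. ?T k"
  have const: "ps_const (CF G) (recip (CF G) (fact k)) \<in> carrier (PS (CF G))" for k
    by (simp add: PS_closed_iff ps_const_def CF_recip_closed)
  have T: "?T k \<in> carrier (PS (CF G))" for k using const h by simp
  have Q: "?Q m \<in> carrier (PS (CF G))" for m using T by (intro PS.finsum_closed) auto
  have Tg: "eval_ps g (?T k) = fps_const (1 / fact k) * eval_ps g h ^ k" if "g \<in> carrier G" for g k
  proof -
    have "eval_ps g (ps_const (CF G) (recip (CF G) (fact k))) = fps_const (1 / fact k)"
      using that by (intro fps_ext) (simp add: ps_const_def CF_recip CF_eval_simps)
    then show ?thesis using that const h by (simp add: eval_ps_simps eval_ps_power)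
  qed
  have Qg: "?Q m n g = (fps_exp 1 oo eval_ps g h) $ n" if "n \<le> m" "g \<in> carrier G" for m n g
  proof -
    have h0: "eval_ps g h $ 0 = 0" using h(2) that(2) by (simp add: CF_eval_simps)
    have "eval_ps g (?Q m) = (\<Sum>k\<le>m. fps_const (1 / fact k) * eval_ps g h ^ k)"
      using eval_ps_finsum[OF that(2), of ?T "{..m}"] T Tg[OF that(2)] by simp
    then have "?Q m n g = (\<Sum>k\<le>m. 1 / fact k * eval_ps g h ^ k $ n)"
      by (metis (no_types, lifting) eval_ps_nth fps_mult_left_const_nth fps_sum_nth sum.cong)
    also have "\<dots> = (\<Sum>k=0..n. 1 / fact k * eval_ps g h ^ k $ n)"
      using that(1) startsby_zero_power_prefix[OF h0] by (intro sum.mono_neutral_right) auto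
    also have "\<dots> = (fps_exp 1 oo eval_ps g h) $ n" by (simp add: fps_compose_nth)
    finally show ?thesis .
  qed
  have P: "ps_exp (CF G) h n = ?Q n n" for n
    unfolding ps_exp_def
  proof (rule ps_lim_eq)
    fix m assume "n \<le> m"
    then show "?Q m n = ?Q n n"
      using Q Qg[of n m] Qg[of n n] by (intro CF_eqI) (auto simp: PS_closed_iff)
  qed
  show "ps_exp (CF G) h \<in> carrier (PS (CF G))" using Q by (auto simp: PS_closed_iff P)
  show "eval_ps g (ps_exp (CF G) h) = fps_exp 1 oo eval_ps g h" if "g \<in> carrier G" for g
    using Qg[OF order_refl that] by (intro fps_ext) (simp add: P)
qed

lemma conj_pow:
  assumes "x \<in> carrier G" "y \<in> carrier G"
  shows "(y \<otimes>\<^bsub>G\<^esub> x \<otimes>\<^bsub>G\<^esub> inv\<^bsub>G\<^esub> y) [^]\<^bsub>G\<^esub> (n::nat) = y \<otimes>\<^bsub>G\<^esub> (x [^]\<^bsub>G\<^esub> n) \<otimes>\<^bsub>G\<^esub> inv\<^bsub>G\<^esub> y"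
proof (induction n)
  case (Suc n)
  have "inv\<^bsub>G\<^esub> y \<otimes>\<^bsub>G\<^esub> (y \<otimes>\<^bsub>G\<^esub> (x \<otimes>\<^bsub>G\<^esub> inv\<^bsub>G\<^esub> y)) = x \<otimes>\<^bsub>G\<^esub> inv\<^bsub>G\<^esub> y"
    using assms by (simp add: m_assoc[symmetric])
  then show ?case using Suc assms by (simp add: m_assoc)
qed (use assms in simp)

section \<open>The lambda structure and its necklace coordinates\<close>

context
  fixes \<chi> assumes \<chi>: "\<chi> \<in> carrier (CF G)"
begin

lemma adams_closed: "adams G n \<chi> \<in> carrier (CF G)"
  unfolding adams_def using \<chi> by (intro CF_restrictI) (simp add: conj_pow CF_closed_iff)

text \<open>At \<open>g\<close> the series is exp of an explicit exponent. Its logarithmic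
  derivative is t times the derivative of that exponent, which cancels the denominators
  \<open>i\<close>.\<close>

lemma lambda_t_closed: "lambda_t G \<chi> \<in> carrier (PS (CF G))"
  and euler_deriv_factor_lambda_t: "\<And>g. g \<in> carrier G \<Longrightarrow>
    euler_deriv_factor (eval_ps g (lambda_t G \<chi>)) (signed_fps (\<lambda>n. \<chi> (g [^]\<^bsub>G\<^esub> n)))"
  and eval_lambda_t_0: "\<And>g. g \<in> carrier G \<Longrightarrow> eval_ps g (lambda_t G \<chi>) $ 0 = 1"
proof -
  define h where "h = (\<lambda>i::nat. if i = 0 then \<zero>\<^bsub>CF G\<^esub>
    else ((\<ominus>\<^bsub>CF G\<^esub> \<one>\<^bsub>CF G\<^esub>) [^]\<^bsub>CF G\<^esub> i) \<otimes>\<^bsub>CF G\<^esub> (recip (CF G) i \<otimes>\<^bsub>CF G\<^esub> adams G i \<chi>))"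
  let ?h = "\<ominus>\<^bsub>PS (CF G)\<^esub> h"
  have h: "h \<in> carrier (PS (CF G))"
    by (simp add: PS_closed_iff h_def CF_recip_closed adams_closed)
  have hg: "?h n g = - (if n = 0 then 0 else (-1) ^ n * (\<chi> (g [^]\<^bsub>G\<^esub> n) / of_nat n))"
    if "g \<in> carrier G" for g n
  proof -
    have "?h n g = - h n g"
      using eval_ps_uminus[OF that h] by (metis eval_ps_nth fps_neg_nth)
    then show ?thesis using that
      by (simp add: h_def CF_eval_simps CF_eval_power CF_eval_uminus CF_recip adams_def)
  qed
  have h': "?h \<in> carrier (PS (CF G))" using h by simp
  have h0: "?h 0 = \<zero>\<^bsub>CF G\<^esub>"
    using h' hg[of _ 0] by (intro CF_eqI) (simp_all add: PS_closed_iff CF_eval_simps)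
  have lam: "lambda_t G \<chi> = ps_exp (CF G) ?h" by (simp add: lambda_t_def h_def)
  show "lambda_t G \<chi> \<in> carrier (PS (CF G))" unfolding lam by (rule PS_exp(1)[OF h' h0])
  fix g assume g: "g \<in> carrier G"
  have ev: "eval_ps g (lambda_t G \<chi>) = fps_exp 1 oo eval_ps g ?h"
    unfolding lam by (rule PS_exp(2)[OF h' h0 g])
  show "eval_ps g (lambda_t G \<chi>) $ 0 = 1" by (simp only: ev fps_compose_nth_0) simp
  have "eval_ps g ?h $ 0 = 0" using hg[OF g, of 0] by simp
  from euler_deriv_factor_exp[OF this]
  have "euler_deriv_factor (eval_ps g (lambda_t G \<chi>)) (fps_X * fps_deriv (eval_ps g ?h))"
    by (simp only: ev)
  moreover have "fps_X * fps_deriv (eval_ps g ?h) = signed_fps (\<lambda>n. \<chi> (g [^]\<^bsub>G\<^esub> n))"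
  proof (rule fps_ext)
    fix n show "(fps_X * fps_deriv (eval_ps g ?h)) $ n = signed_fps (\<lambda>n. \<chi> (g [^]\<^bsub>G\<^esub> n)) $ n"
      unfolding fps_X_mult_deriv_nth eval_ps_nth hg[OF g] by (simp add: signed_fps_nth)
  qed
  ultimately show "euler_deriv_factor (eval_ps g (lambda_t G \<chi>)) (signed_fps (\<lambda>n. \<chi> (g [^]\<^bsub>G\<^esub> n)))"
    by simp
qed

lemma lambda_t_Lam: "lambda_t G \<chi> \<in> Lam (CF G)"
proof -
  have "lambda_t G \<chi> 0 = \<one>\<^bsub>CF G\<^esub>"
    using lambda_t_closed eval_lambda_t_0 by (intro CF_eqI) (simp_all add: PS_closed_iff CF_eval_simps)
  then show ?thesis using lambda_t_closed by (simp add: Lam_def)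
qed

text \<open>This turns the equation defining \<open>E_Nr\<close> into the ghost component equations
  at each group element.\<close>

lemma lambda_t_eq_limit_iff:
  assumes "a \<in> carrier (Nr (CF G))"
  shows "lambda_t G \<chi> = ps_lim (\<lambda>m. \<Otimes>\<^bsub>PS (CF G)\<^esub>i\<in>{1..m}. necklace_factor (CF G) i (a i)) \<longleftrightarrow>
    (\<forall>g\<in>carrier G. \<forall>n>0. \<chi> (g [^]\<^bsub>G\<^esub> n) = divisor_sum (\<lambda>i. a i g) n)"
    (is "_ = ?P \<longleftrightarrow> _")
proof -
  have "lambda_t G \<chi> = ?P \<longleftrightarrow> (\<forall>g\<in>carrier G. eval_ps g (lambda_t G \<chi>) = eval_ps g ?P)"
    using PS_eqI[OF lambda_t_closed necklace_limit(1)[OF assms]] by auto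
  also have "\<dots> \<longleftrightarrow> (\<forall>g\<in>carrier G. eval_ps g (lambda_t G \<chi>) = necklace_product (\<lambda>i. a i g))"
    using necklace_limit(2)[OF assms] by simp
  also have "\<dots> \<longleftrightarrow> (\<forall>g\<in>carrier G. \<forall>n>0. \<chi> (g [^]\<^bsub>G\<^esub> n) = divisor_sum (\<lambda>i. a i g) n)"
    using eq_necklace_product_iff[OF euler_deriv_factor_lambda_t eval_lambda_t_0] by simp
  finally show ?thesis .
qed

lemma E_Nr_lambda_t:
  shows E_Nr_lambda_t_closed: "E_Nr (CF G) (lambda_t G \<chi>) \<in> carrier (Nr (CF G))"
    and divisor_sum_E_Nr_lambda_t: "\<And>g n. g \<in> carrier G \<Longrightarrow> n > 0 \<Longrightarrow>
      divisor_sum (\<lambda>i. E_Nr (CF G) (lambda_t G \<chi>) i g) n = \<chi> (g [^]\<^bsub>G\<^esub> n)"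
proof -
  let ?R = "\<lambda>a. a \<in> carrier (Nr (CF G)) \<and>
    lambda_t G \<chi> = ps_lim (\<lambda>m. \<Otimes>\<^bsub>PS (CF G)\<^esub>i\<in>{1..m}. necklace_factor (CF G) i (a i))"
  \<comment> \<open>The witness is obtained by Moebius inversion at each \<open>g\<close>. It
    consists of class functions because conjugation commutes with taking powers.\<close>
  define a where "a = (\<lambda>n\<in>{1::nat..}. \<lambda>g\<in>carrier G. necklace (\<lambda>k. \<chi> (g [^]\<^bsub>G\<^esub> k)) n)"
  have a: "a \<in> carrier (Nr (CF G))"
    using \<chi> unfolding Nr_closed_iff a_def
    by (auto simp: conj_pow CF_closed_iff)
  have "divisor_sum (\<lambda>i. a i g) n = \<chi> (g [^]\<^bsub>G\<^esub> n)" if "g \<in> carrier G" "n > 0" for g n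
  proof -
    have "divisor_sum (\<lambda>i. a i g) n = divisor_sum (necklace (\<lambda>k. \<chi> (g [^]\<^bsub>G\<^esub> k))) n"
      unfolding divisor_sum_def using that dvd_pos_nat[OF that(2)]
      by (intro sum.cong) (auto simp: a_def Suc_le_eq)
    then show ?thesis using that divisor_sum_necklace by simp
  qed
  then have Ra: "?R a" using a lambda_t_eq_limit_iff[OF a] by simp
  \<comment> \<open>Uniqueness makes the definite description in \<open>E_Nr\<close> meaningful:
    ghost components determine the values at each \<open>g\<close>, and both vectors are
    extensional.\<close>
  moreover have "b = a" if "?R b" for b
  proof (rule extensionalityI[of _ "{1..}"])
    fix n :: nat assume n: "n \<in> {1..}"
    show "b n = a n"
    proof (rule CF_eqI)
      fix g assume g: "g \<in> carrier G"
      have "divisor_sum (\<lambda>i. b i g) m = divisor_sum (\<lambda>i. a i g) m" if "m > 0" for m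
        using lambda_t_eq_limit_iff[of a] lambda_t_eq_limit_iff[of b] Ra \<open>?R b\<close> g that by metis
      then show "b n g = a n g"
        using divisor_sum_inject[of "\<lambda>i. b i g" "\<lambda>i. a i g" n] n by simp
    qed (use that a n in \<open>auto simp: Nr_closed_iff\<close>)
  qed (use that a in \<open>auto simp: Nr_closed_iff\<close>)
  ultimately have "?R (THE a. ?R a)" by (rule theI)
  moreover have "E_Nr (CF G) (lambda_t G \<chi>) = (THE a. ?R a)"
    using lambda_t_Lam by (simp add: E_Nr_def)
  ultimately have R: "?R (E_Nr (CF G) (lambda_t G \<chi>))" by simp
  then show "E_Nr (CF G) (lambda_t G \<chi>) \<in> carrier (Nr (CF G))" by blast
  from R lambda_t_eq_limit_iff[OF this]
  show "divisor_sum (\<lambda>i. E_Nr (CF G) (lambda_t G \<chi>) i g) n = \<chi> (g [^]\<^bsub>G\<^esub> n)"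
    if "g \<in> carrier G" "n > 0" for g n
    using that by simp
qed

end

text \<open>The truncation is idempotent, so a vector supported on the divisors of \<open>e\<close>
  is its own preimage.\<close>

lemma truncated_image_iff:
  assumes "a \<in> carrier (Nr (CF G))"
  shows "a \<in> truncated (CF G) e ` carrier (Nr (CF G)) \<longleftrightarrow>
    (\<forall>g\<in>carrier G. \<forall>n>0. \<not> n dvd e \<longrightarrow> a n g = 0)"
proof
  assume "a \<in> truncated (CF G) e ` carrier (Nr (CF G))"
  then show "\<forall>g\<in>carrier G. \<forall>n>0. \<not> n dvd e \<longrightarrow> a n g = 0"
    by (auto simp: truncated_def CF_eval_simps)
next
  assume *: "\<forall>g\<in>carrier G. \<forall>n>0. \<not> n dvd e \<longrightarrow> a n g = 0"
  have "a n = \<zero>\<^bsub>CF G\<^esub>" if "n > 0" "\<not> n dvd e" for n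
    using * that assms by (intro CF_eqI) (auto simp: Nr_closed_iff CF_eval_simps)
  then have "truncated (CF G) e a = a"
    using assms by (intro extensionalityI[of _ "{1..}"]) (auto simp: truncated_def Nr_closed_iff)
  then show "a \<in> truncated (CF G) e ` carrier (Nr (CF G))" using assms by (metis imageI)
qed

lemma lambda_t_finite_product:
  assumes "\<chi> \<in> carrier (CF G)" "e > 0"
  defines "a \<equiv> E_Nr (CF G) (lambda_t G \<chi>)"
  assumes a0: "\<And>g n. g \<in> carrier G \<Longrightarrow> n > 0 \<Longrightarrow> \<not> n dvd e \<Longrightarrow> a n g = 0"
  shows "lambda_t G \<chi> = (\<Otimes>\<^bsub>PS (CF G)\<^esub>d\<in>{d. d dvd e}. necklace_factor (CF G) d (a d))"
proof (rule PS_eqI)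
  have a: "a \<in> carrier (Nr (CF G))" unfolding a_def by (rule E_Nr_lambda_t_closed[OF assms(1)])
  have pos: "d > 0" if "d dvd e" for d using that dvd_pos_nat[OF assms(2)] by blast
  have factor: "necklace_factor (CF G) d (a d) \<in> carrier (PS (CF G))" if "d dvd e" for d
    using a pos[OF that] by (intro necklace_factor_closed) (simp add: Nr_closed_iff)
  then show "(\<Otimes>\<^bsub>PS (CF G)\<^esub>d\<in>{d. d dvd e}. necklace_factor (CF G) d (a d)) \<in> carrier (PS (CF G))"
    by (intro PS.finprod_closed) auto
  show "lambda_t G \<chi> \<in> carrier (PS (CF G))" by (rule lambda_t_closed[OF assms(1)])
  fix g assume g: "g \<in> carrier G"
  have "eval_ps g (lambda_t G \<chi>) = necklace_product (\<lambda>i. a i g)"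
    using eq_necklace_product_iff[OF euler_deriv_factor_lambda_t[OF assms(1) g] eval_lambda_t_0[OF assms(1) g]]
      divisor_sum_E_Nr_lambda_t[OF assms(1) g] by (simp add: a_def)
  also have "\<dots> = (\<Prod>d | d dvd e. necklace_fps d (a d g))"
    using assms(2) a0 g by (intro necklace_product_finite) auto
  also have "\<dots> = (\<Prod>d | d dvd e. eval_ps g (necklace_factor (CF G) d (a d)))"
    using a g pos by (intro prod.cong refl eval_ps_necklace_factor[symmetric]) (auto simp: Nr_closed_iff)
  also have "\<dots> = eval_ps g (\<Otimes>\<^bsub>PS (CF G)\<^esub>d\<in>{d. d dvd e}. necklace_factor (CF G) d (a d))"
    using factor by (intro eval_ps_finprod[OF g, symmetric]) auto
  finally show "eval_ps g (lambda_t G \<chi>) = \<dots>" .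
qed

end

theorem theorem3p20:
  fixes G :: "('a, 'm) monoid_scheme" and e :: nat
    and \<chi> :: "'a \<Rightarrow> complex" and \<alpha> :: "nat \<Rightarrow> 'a \<Rightarrow> complex"
  assumes "group G" and "finite (carrier G)"
    and "e = exponent G"
    and "\<chi> \<in> virtual_characters G"
    and "\<alpha> = E_Nr (CF G) (lambda_t G \<chi>)"
  shows "(integer_valued G \<chi> \<longleftrightarrow> \<alpha> \<in> truncated (CF G) e ` carrier (Nr (CF G))) \<and>
    (integer_valued G \<chi> \<longrightarrow>
       lambda_t G \<chi> = (\<Otimes>\<^bsub>PS (CF G)\<^esub>d\<in>{d. d dvd e}. necklace_factor (CF G) d (\<alpha> d)))"
proof -
  note fin = \<open>finite (carrier G)\<close>
  interpret group G by fact
  have e: "e > 0" using exponent_pos[OF fin] \<open>e = exponent G\<close> by simp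
  have "\<chi> \<in> extensional (carrier G)"
    using assms(4) by (auto simp: virtual_characters_def)
  then have \<chi>: "\<chi> \<in> carrier (CF G)"
    using virtual_character_conj[OF assms(1,4)] by (simp add: CF_closed_iff[OF assms(1)])
  have \<alpha>: "\<alpha> \<in> carrier (Nr (CF G))"
    unfolding \<open>\<alpha> = _\<close> by (rule E_Nr_lambda_t_closed[OF assms(1) \<chi>])
  have sums: "divisor_sum (\<lambda>i. \<alpha> i g) n = \<chi> (g [^]\<^bsub>G\<^esub> n)" if "g \<in> carrier G" "n > 0" for g n
    unfolding \<open>\<alpha> = _\<close> by (rule divisor_sum_E_Nr_lambda_t[OF assms(1) \<chi> that])
  have root_sum: "root_sum e (\<lambda>k. \<chi> (g [^]\<^bsub>G\<^esub> k))" if "g \<in> carrier G" for g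
    using root_sum_virtual_character[OF assms(1) fin assms(4) that] \<open>e = exponent G\<close> by simp
  have image: "\<alpha> \<in> truncated (CF G) e ` carrier (Nr (CF G)) \<longleftrightarrow>
      (\<forall>g\<in>carrier G. \<forall>n>0. \<not> n dvd e \<longrightarrow> \<alpha> n g = 0)"
    by (rule truncated_image_iff[OF assms(1) \<alpha>])
  \<comment> \<open>The ghost components of \<open>\<alpha>\<close> at \<open>g\<close> are the
    values of \<open>\<chi>\<close> at the powers of \<open>g\<close>, so membership in the image
    becomes a gcd condition on these values.\<close>
  have "(\<forall>n>0. \<not> n dvd e \<longrightarrow> \<alpha> n g = 0) \<longleftrightarrow>
      (\<forall>n>0. \<chi> (g [^]\<^bsub>G\<^esub> n) = \<chi> (g [^]\<^bsub>G\<^esub> gcd n e))" if g: "g \<in> carrier G" for g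
  proof -
    have "divisor_sum (\<lambda>i. \<alpha> i g) (gcd n e) = \<chi> (g [^]\<^bsub>G\<^esub> gcd n e)" if "n > 0" for n
      using that by (intro sums g) simp
    then show ?thesis
      unfolding divisor_sum_supported_iff[OF e, of "\<lambda>i. \<alpha> i g", symmetric]
      using sums[OF g] by simp
  qed
  then have image_gcd: "\<alpha> \<in> truncated (CF G) e ` carrier (Nr (CF G)) \<longleftrightarrow>
      (\<forall>g\<in>carrier G. \<forall>n>0. \<chi> (g [^]\<^bsub>G\<^esub> n) = \<chi> (g [^]\<^bsub>G\<^esub> gcd n e))"
    unfolding image by blast
  have equiv: "integer_valued G \<chi> \<longleftrightarrow> \<alpha> \<in> truncated (CF G) e ` carrier (Nr (CF G))"
    unfolding image_gcd
  proof
    assume "integer_valued G \<chi>"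
    then have "\<chi> (g [^]\<^bsub>G\<^esub> n) \<in> \<int>" if "g \<in> carrier G" for g and n :: nat
      using that by (simp add: integer_valued_def)
    then show "\<forall>g\<in>carrier G. \<forall>n>0. \<chi> (g [^]\<^bsub>G\<^esub> n) = \<chi> (g [^]\<^bsub>G\<^esub> gcd n e)"
      using root_sum_Ints_imp_gcd[OF root_sum e] by blast
  next
    assume gcd: "\<forall>g\<in>carrier G. \<forall>n>0. \<chi> (g [^]\<^bsub>G\<^esub> n) = \<chi> (g [^]\<^bsub>G\<^esub> gcd n e)"
    have "\<chi> g \<in> \<int>" if "g \<in> carrier G" for g
    proof -
      \<comment> \<open>The value of \<open>\<chi>\<close> at \<open>g\<close> is the term of index
        1 of the sequence along the powers of \<open>g\<close>.\<close>
      have "\<chi> (g [^]\<^bsub>G\<^esub> (1::nat)) \<in> \<int>"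
        by (rule root_sum_gcd_imp_Ints[OF root_sum[OF that] e]) (use gcd that in blast)
      then show ?thesis using that by simp
    qed
    then show "integer_valued G \<chi>" by (simp add: integer_valued_def)
  qed
  moreover have "lambda_t G \<chi> = (\<Otimes>\<^bsub>PS (CF G)\<^esub>d\<in>{d. d dvd e}. necklace_factor (CF G) d (\<alpha> d))"
    if "integer_valued G \<chi>"
    unfolding \<open>\<alpha> = _\<close>
    using that image equiv
    by (intro lambda_t_finite_product[OF assms(1) \<chi> e]) (simp add: \<open>\<alpha> = _\<close>)
  ultimately show ?thesis by blast
qed

end
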